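(* Let $m,d\in\mathbb{N}$ be positive integers, let $K_1,\ldots,K_m\in\mathbb{C}^{d\times d}$, and let $T:\mathbb{C}^{d\times d}\to\mathbb{C}^{d\times d}$ be the completely positive map with Kraus operators $(K_l)_{l=1}^m$, that is, $T(X):=\sum_{l=1}^m K_lXK_l^*$. Then the singular values of $T$ satisfy the weak majorization $$\sigma(T)\ \prec_w\ \sum_{l=1}^m\sigma(K_l)\otimes\sigma(K_l).$$
   Context: $K^*$ denotes the conjugate transpose of $K$. For $A\in\mathbb{C}^{d\times d}$, $\sigma(A)=(\sigma_1(A),\ldots,\sigma_d(A))\in\mathbb{R}^d$ denotes the vector of singular values (with multiplicity) in nonincreasing order. The space $\mathbb{C}^{d\times d}$ is equipped with the Hilbert–Schmidt inner product $\langle X,Y\rangle=\operatorname{tr}[X^*Y]$, and $\sigma(T)\in\mathbb{R}^{d^2}$ denotes the nonincreasingly ordered vector of singular values (with multiplicity) of $T$, viewed as a linear operator on this $d^2$-dimensional Hilbert space. For vectors $x,y\in\mathbb{R}^{d}$, $x\otimes y\in\mathbb{R}^{d^2}$ is the vector with entries $x_iy_j$ indexed by pairs $(i,j)$, and sums of such vectors are taken entrywise at the same index $(i,j)$. For $x,y\in\mathbb{R}^n$, weak majorization $x\prec_w y$ means $\sum_{i=1}^k x_i^\downarrow\leq\sum_{i=1}^k y_i^\downarrow$ for all $k\in\{1,\ldots,n\}$, where $x^\downarrow$ is the rearrangement of the entries of $x$ in nonincreasing order. *)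

theory Defs
  imports
    "HOL-Computational_Algebra.Fundamental_Theorem_Algebra"
    "Jordan_Normal_Form.Schur_Decomposition"
begin

text \<open>
  The library's \<open>mat_adjoint\<close> is the conjugate transpose. Singular values are the square roots of
  the eigenvalues of \<open>A\<^sup>* A\<close>, counted with algebraic multiplicity; these eigenvalues are
  nonnegative reals, so taking \<open>Re\<close> loses nothing.
\<close>

definition singular_values :: "complex mat \<Rightarrow> real vec" where
  "singular_values A =
     vec_of_list (rev (sorted_list_of_multiset
       (image_mset (\<lambda>z. sqrt (Re z)) (proots (char_poly (mat_adjoint A * A))))))"

definition mat_trace :: "'a::comm_monoid_add mat \<Rightarrow> 'a" where
  "mat_trace A = (\<Sum>i<dim_row A. A $$ (i, i))"

definition hs_inner :: "complex mat \<Rightarrow> complex mat \<Rightarrow> complex" where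
  "hs_inner X Y = mat_trace (mat_adjoint X * Y)"

text \<open>The pair \<open>(i, j)\<close> with \<open>i, j < d\<close> is encoded as the index \<open>i * d + j < d * d\<close> throughout.\<close>

definition matrix_unit :: "nat \<Rightarrow> nat \<Rightarrow> complex mat" where
  "matrix_unit d a = mat d d (\<lambda>(i, j). if i = a div d \<and> j = a mod d then 1 else 0)"

definition op_matrix ::
    "nat \<Rightarrow> (nat \<Rightarrow> complex mat) \<Rightarrow> (complex mat \<Rightarrow> complex mat) \<Rightarrow> complex mat" where
  "op_matrix d B T = mat (d * d) (d * d) (\<lambda>(a, b). hs_inner (B a) (T (B b)))"

text \<open>
  The singular values of a linear operator on the Hilbert--Schmidt space of \<open>d \<times> d\<close> matrices are
  those of its matrix in an orthonormal basis; \<open>op_singular_values_basis_independent\<close> below shows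
  that every orthonormal basis gives the same vector.
\<close>

definition op_singular_values :: "nat \<Rightarrow> (complex mat \<Rightarrow> complex mat) \<Rightarrow> real vec" where
  "op_singular_values d T = singular_values (op_matrix d (matrix_unit d) T)"

definition kraus_map ::
    "nat \<Rightarrow> nat \<Rightarrow> (nat \<Rightarrow> complex mat) \<Rightarrow> complex mat \<Rightarrow> complex mat" where
  "kraus_map d m K X = mat d d (\<lambda>ij. \<Sum>l=1..m. (K l * X * mat_adjoint (K l)) $$ ij)"

definition tensor_vec :: "real vec \<Rightarrow> real vec \<Rightarrow> real vec" (infixl "\<otimes>\<^sub>v" 70) where
  "x \<otimes>\<^sub>v y = vec (dim_vec x * dim_vec y) (\<lambda>k. x $ (k div dim_vec y) * y $ (k mod dim_vec y))"

definition decreasing_rearrangement :: "real vec \<Rightarrow> real vec" where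
  "decreasing_rearrangement x = vec_of_list (rev (sort (list_of_vec x)))"

definition weakly_majorized :: "real vec \<Rightarrow> real vec \<Rightarrow> bool" (infix "\<prec>\<^sub>w" 50) where
  "x \<prec>\<^sub>w y \<longleftrightarrow> dim_vec x = dim_vec y \<and>
     (\<forall>k\<in>{1..dim_vec x}.
        (\<Sum>i<k. decreasing_rearrangement x $ i) \<le> (\<Sum>i<k. decreasing_rearrangement y $ i))"


lemma dim_mat_adjoint [simp]:
  "dim_row (mat_adjoint A) = dim_col A" "dim_col (mat_adjoint A) = dim_row A"
  by (auto simp: mat_adjoint_def)

lemma index_mat_adjoint [simp]:
  "i < dim_col A \<Longrightarrow> j < dim_row A \<Longrightarrow> mat_adjoint A $$ (i, j) = conjugate (A $$ (j, i))"
  by (simp add: mat_adjoint_def mat_of_rows_index)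

lemma mat_adjoint_carrier [simp]: "A \<in> carrier_mat n m \<Longrightarrow> mat_adjoint A \<in> carrier_mat m n"
  by auto

lemma mat_adjoint_mult:
  fixes A B :: "complex mat"
  assumes "A \<in> carrier_mat n m" "B \<in> carrier_mat m k"
  shows "mat_adjoint (A * B) = mat_adjoint B * mat_adjoint A"
  using assms by (intro eq_matI) (auto simp: scalar_prod_def mult.commute)

lemma mat_adjoint_adjoint: "mat_adjoint (mat_adjoint (A :: complex mat)) = A"
  by (intro eq_matI) auto

lemma dim_singular_values:
  assumes "A \<in> carrier_mat n m"
  shows "dim_vec (singular_values A) = m"
proof -
  have "mat_adjoint A * A \<in> carrier_mat m m" using assms by auto
  then have "degree (char_poly (mat_adjoint A * A)) = m"
    using degree_monic_char_poly by blast
  then show ?thesis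
    by (simp add: singular_values_def size_proots_complex size_mset [symmetric] del: size_mset)
qed

lemma pair_index_less:
  assumes "i < d" "j < d" shows "i * d + j < d * (d :: nat)"
proof -
  have "i * d + j < Suc i * d" using assms by simp
  also have "\<dots> \<le> d * d" using assms by (intro mult_le_mono1) simp
  finally show ?thesis .
qed

lemma hs_inner_eq_sum:
  assumes "X \<in> carrier_mat d d" "Y \<in> carrier_mat d d"
  shows "hs_inner X Y = (\<Sum>a<d * d. cnj (X $$ (a div d, a mod d)) * Y $$ (a div d, a mod d))"
proof -
  have "hs_inner X Y = (\<Sum>j<d. \<Sum>i<d. cnj (X $$ (i, j)) * Y $$ (i, j))"
    using assms by (simp add: hs_inner_def mat_trace_def scalar_prod_def atLeast0LessThan)
  also have "\<dots> = (\<Sum>i<d. \<Sum>j<d. cnj (X $$ (i, j)) * Y $$ (i, j))"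
    by (rule sum.swap)
  also have "\<dots> = (\<Sum>(i, j)\<in>{..<d} \<times> {..<d}. cnj (X $$ (i, j)) * Y $$ (i, j))"
    by (simp add: sum.cartesian_product)
  also have "\<dots> = (\<Sum>a<d * d. cnj (X $$ (a div d, a mod d)) * Y $$ (a div d, a mod d))"
  proof (rule sum.reindex_bij_witness [of _ "\<lambda>a. (a div d, a mod d)" "\<lambda>(i, j). i * d + j"])
    fix p :: "nat \<times> nat" assume p: "p \<in> {..<d} \<times> {..<d}"
    then show "(case p of (i, j) \<Rightarrow> i * d + j) \<in> {..<d * d}"
      using pair_index_less by auto
  next
    fix a assume "a \<in> {..<d * d}"
    then show "(a div d, a mod d) \<in> {..<d} \<times> {..<d}"
      by (cases "d = 0") (auto simp: less_mult_imp_div_less)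
  qed auto
  finally show ?thesis .
qed

lemma index_div_mod:
  assumes "a < d * d" shows "a div d < d" "a mod d < (d :: nat)"
  using assms by (cases "d = 0"; auto simp: less_mult_imp_div_less)+

lemma matrix_unit_carrier [simp]: "matrix_unit d a \<in> carrier_mat d d"
  by (simp add: matrix_unit_def)

lemma index_eq_iff: "a div d = b div d \<and> a mod d = b mod d \<longleftrightarrow> a = (b :: nat)"
  by (metis div_mult_mod_eq)

lemma hs_inner_matrix_unit:
  assumes "a < d * d" "X \<in> carrier_mat d d"
  shows "hs_inner (matrix_unit d a) X = X $$ (a div d, a mod d)"
proof -
  have "hs_inner (matrix_unit d a) X =
      (\<Sum>b<d * d. if b = a then X $$ (b div d, b mod d) else 0)"
    using assms index_div_mod [of _ d]
    by (subst hs_inner_eq_sum [of _ d]) (simp_all add: matrix_unit_def index_eq_iff if_distrib [of cnj] if_distrib [of "\<lambda>x. x * _"] cong: if_cong)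
  then show ?thesis using assms by simp
qed

definition orthonormal_basis :: "nat \<Rightarrow> (nat \<Rightarrow> complex mat) \<Rightarrow> bool" where
  "orthonormal_basis d B \<longleftrightarrow>
     (\<forall>a<d * d. B a \<in> carrier_mat d d) \<and>
     (\<forall>a<d * d. \<forall>b<d * d. hs_inner (B a) (B b) = (if a = b then 1 else 0))"

lemma orthonormal_basis_matrix_unit: "orthonormal_basis d (matrix_unit d)"
proof -
  have "hs_inner (matrix_unit d a) (matrix_unit d b) = (if a = b then 1 else 0)"
    if "a < d * d" "b < d * d" for a b
    using that index_div_mod [OF that(1)] gr_zeroI [of d]
    by (simp add: hs_inner_matrix_unit) (auto simp: matrix_unit_def index_eq_iff)
  then show ?thesis by (simp add: orthonormal_basis_def)
qed

definition linear_on_mat :: "nat \<Rightarrow> (complex mat \<Rightarrow> complex mat) \<Rightarrow> bool" where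
  "linear_on_mat d T \<longleftrightarrow>
     (\<forall>X\<in>carrier_mat d d. T X \<in> carrier_mat d d) \<and>
     (\<forall>X\<in>carrier_mat d d. \<forall>Y\<in>carrier_mat d d. T (X + Y) = T X + T Y) \<and>
     (\<forall>c. \<forall>X\<in>carrier_mat d d. T (c \<cdot>\<^sub>m X) = c \<cdot>\<^sub>m T X)"

lemma linear_on_mat_kraus_map:
  assumes K: "\<And>l. l \<in> {1..m} \<Longrightarrow> K l \<in> carrier_mat d d"
  shows "linear_on_mat d (kraus_map d m K)"
proof -
  have entry: "kraus_map d m K X $$ (i, j) =
      (\<Sum>l=1..m. \<Sum>q<d. (\<Sum>p<d. K l $$ (i, p) * X $$ (p, q)) * cnj (K l $$ (j, q)))"
    if X: "X \<in> carrier_mat d d" and ij: "i < d" "j < d" for X i j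
  proof -
    have "(K l * X * mat_adjoint (K l)) $$ (i, j) =
        (\<Sum>q<d. (\<Sum>p<d. K l $$ (i, p) * X $$ (p, q)) * cnj (K l $$ (j, q)))"
      if "l \<in> {1..m}" for l
      using K [OF that] X ij by (simp add: scalar_prod_def atLeast0LessThan)
    then show ?thesis using ij by (simp add: kraus_map_def)
  qed
  have carrier: "kraus_map d m K X \<in> carrier_mat d d" for X
    by (simp add: kraus_map_def)
  show ?thesis
    unfolding linear_on_mat_def
  proof (intro conjI ballI allI)
    fix X Y :: "complex mat" assume XY: "X \<in> carrier_mat d d" "Y \<in> carrier_mat d d"
    show "kraus_map d m K (X + Y) = kraus_map d m K X + kraus_map d m K Y"
    proof (rule eq_matI)
      fix i j
      assume "i < dim_row (kraus_map d m K X + kraus_map d m K Y)"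
        "j < dim_col (kraus_map d m K X + kraus_map d m K Y)"
      then have ij: "i < d" "j < d" by (simp_all add: kraus_map_def)
      have "X + Y \<in> carrier_mat d d" using XY by simp
      then show "kraus_map d m K (X + Y) $$ (i, j) = (kraus_map d m K X + kraus_map d m K Y) $$ (i, j)"
        using ij XY carrier_matD [OF carrier]
        by (simp add: entry sum.distrib distrib_left distrib_right)
    qed (simp_all add: kraus_map_def)
  next
    fix c and X :: "complex mat" assume X: "X \<in> carrier_mat d d"
    show "kraus_map d m K (c \<cdot>\<^sub>m X) = c \<cdot>\<^sub>m kraus_map d m K X"
    proof (rule eq_matI)
      fix i j
      assume "i < dim_row (c \<cdot>\<^sub>m kraus_map d m K X)" "j < dim_col (c \<cdot>\<^sub>m kraus_map d m K X)"
      then have ij: "i < d" "j < d" by (simp_all add: kraus_map_def)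
      have "c \<cdot>\<^sub>m X \<in> carrier_mat d d" using X by simp
      then show "kraus_map d m K (c \<cdot>\<^sub>m X) $$ (i, j) = (c \<cdot>\<^sub>m kraus_map d m K X) $$ (i, j)"
        using ij X carrier_matD [OF carrier]
        by (simp add: entry sum_distrib_left sum_distrib_right mult_ac)
    qed (simp_all add: kraus_map_def)
  qed (rule carrier)
qed

lemma linear_on_mat_expand:
  assumes T: "linear_on_mat d T" and X: "X \<in> carrier_mat d d" and ij: "i < d" "j < d"
  shows "T X $$ (i, j) =
    (\<Sum>b<d * d. X $$ (b div d, b mod d) * T (matrix_unit d b) $$ (i, j))"
proof -
  define P where "P n = mat d d (\<lambda>(i, j). if i * d + j < n then X $$ (i, j) else 0)" for n
  have carrier: "T Y \<in> carrier_mat d d" if "Y \<in> carrier_mat d d" for Y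
    using T that by (simp add: linear_on_mat_def)
  have add: "T (Y + Z) = T Y + T Z" if "Y \<in> carrier_mat d d" "Z \<in> carrier_mat d d" for Y Z
    using T that unfolding linear_on_mat_def by blast
  have smult: "T (c \<cdot>\<^sub>m Y) = c \<cdot>\<^sub>m T Y" if "Y \<in> carrier_mat d d" for c Y
    using T that unfolding linear_on_mat_def by blast
  have zero: "T (0\<^sub>m d d) = 0\<^sub>m d d"
  proof -
    have "0 \<cdot>\<^sub>m 0\<^sub>m d d = (0\<^sub>m d d :: complex mat)" by (intro eq_matI) auto
    moreover have "T (0 \<cdot>\<^sub>m 0\<^sub>m d d) = 0 \<cdot>\<^sub>m T (0\<^sub>m d d)" by (rule smult) simp
    moreover have "0 \<cdot>\<^sub>m T (0\<^sub>m d d) = 0\<^sub>m d d"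
      using carrier [of "0\<^sub>m d d"] by (intro eq_matI) auto
    ultimately show ?thesis by simp
  qed
  have step: "P (Suc n) = P n + X $$ (n div d, n mod d) \<cdot>\<^sub>m matrix_unit d n" if "n < d * d" for n
  proof (intro eq_matI)
    fix i j
    assume "i < dim_row (P n + X $$ (n div d, n mod d) \<cdot>\<^sub>m matrix_unit d n)"
      "j < dim_col (P n + X $$ (n div d, n mod d) \<cdot>\<^sub>m matrix_unit d n)"
    then have ij: "i < d" "j < d" by (simp_all add: matrix_unit_def)
    then have "i = n div d \<and> j = n mod d \<longleftrightarrow> i * d + j = n"
      using index_eq_iff [of "i * d + j" d n] by simp
    then show "P (Suc n) $$ (i, j) =
        (P n + X $$ (n div d, n mod d) \<cdot>\<^sub>m matrix_unit d n) $$ (i, j)"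
      using ij by (auto simp: P_def matrix_unit_def less_Suc_eq)
  qed (simp_all add: P_def matrix_unit_def)
  have partial: "T (P n) $$ (i, j) =
      (\<Sum>b<n. X $$ (b div d, b mod d) * T (matrix_unit d b) $$ (i, j))" if "n \<le> d * d" for n
    using that
  proof (induction n)
    case 0
    have "P 0 = 0\<^sub>m d d" by (intro eq_matI) (auto simp: P_def)
    then show ?case using zero ij by simp
  next
    case (Suc n)
    have "P n \<in> carrier_mat d d" by (simp add: P_def)
    then have "T (P (Suc n)) = T (P n) + X $$ (n div d, n mod d) \<cdot>\<^sub>m T (matrix_unit d n)"
      using Suc.prems by (simp add: step add smult)
    moreover have "T (P n) \<in> carrier_mat d d" "T (matrix_unit d n) \<in> carrier_mat d d"
      by (auto intro!: carrier simp: P_def)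
    ultimately show ?case using Suc ij by simp
  qed
  have "P (d * d) = X" using X pair_index_less by (intro eq_matI) (auto simp: P_def)
  then show ?thesis using partial [of "d * d"] by simp
qed

lemma op_singular_values_basis_independent:
  assumes T: "linear_on_mat d T" and B: "orthonormal_basis d B"
  shows "singular_values (op_matrix d B T) = op_singular_values d T"
proof -
  let ?n = "d * d"
  define U where "U = mat ?n ?n (\<lambda>(a, b). B b $$ (a div d, a mod d))"
  define M where "M = op_matrix d (matrix_unit d) T"
  define N where "N = op_matrix d B T"
  have [simp]: "U \<in> carrier_mat ?n ?n" "M \<in> carrier_mat ?n ?n" "N \<in> carrier_mat ?n ?n"
    by (simp_all add: U_def M_def N_def op_matrix_def)
  have Bc: "B a \<in> carrier_mat d d" if "a < ?n" for a
    using B that by (simp add: orthonormal_basis_def)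
  have Tc: "T Y \<in> carrier_mat d d" if "Y \<in> carrier_mat d d" for Y
    using T that by (simp add: linear_on_mat_def)
  have UU: "mat_adjoint U * U = 1\<^sub>m ?n"
  proof (intro eq_matI)
    fix a b assume "a < dim_row (1\<^sub>m ?n :: complex mat)" "b < dim_col (1\<^sub>m ?n :: complex mat)"
    then have ab: "a < ?n" "b < ?n" by auto
    have "(mat_adjoint U * U) $$ (a, b) = hs_inner (B a) (B b)"
      using ab by (simp add: hs_inner_eq_sum [OF Bc Bc] U_def scalar_prod_def atLeast0LessThan)
    then show "(mat_adjoint U * U) $$ (a, b) = 1\<^sub>m ?n $$ (a, b)"
      using ab B by (simp add: orthonormal_basis_def)
  qed (simp_all add: U_def)
  then have UU': "U * mat_adjoint U = 1\<^sub>m ?n"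
    by (rule mat_mult_left_right_inverse [of _ ?n, rotated 2]) simp_all
  have MU: "M * U = mat ?n ?n (\<lambda>(a, b). T (B b) $$ (a div d, a mod d))"
  proof (intro eq_matI)
    fix a b
    assume "a < dim_row (mat ?n ?n (\<lambda>(a, b). T (B b) $$ (a div d, a mod d)))"
      "b < dim_col (mat ?n ?n (\<lambda>(a, b). T (B b) $$ (a div d, a mod d)))"
    then have ab: "a < ?n" "b < ?n" by auto
    have "(M * U) $$ (a, b) =
        (\<Sum>c<?n. T (matrix_unit d c) $$ (a div d, a mod d) * B b $$ (c div d, c mod d))"
      using ab by (simp add: M_def op_matrix_def U_def scalar_prod_def hs_inner_matrix_unit Tc
          atLeast0LessThan)
    also have "\<dots> = T (B b) $$ (a div d, a mod d)"
      using linear_on_mat_expand [OF T Bc [OF ab(2)] index_div_mod [OF ab(1)]]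
      by (simp add: mult.commute)
    finally show "(M * U) $$ (a, b) =
        mat ?n ?n (\<lambda>(a, b). T (B b) $$ (a div d, a mod d)) $$ (a, b)"
      using ab by simp
  qed (simp_all add: M_def U_def op_matrix_def)
  have N: "N = mat_adjoint U * (M * U)"
  proof (intro eq_matI)
    fix a b
    assume "a < dim_row (mat_adjoint U * (M * U))" "b < dim_col (mat_adjoint U * (M * U))"
    then have ab: "a < ?n" "b < ?n" by (auto simp: U_def)
    have "(mat_adjoint U * (M * U)) $$ (a, b) = hs_inner (B a) (T (B b))"
      unfolding MU using ab
      by (simp add: U_def scalar_prod_def atLeast0LessThan
          hs_inner_eq_sum [OF Bc [OF ab(1)] Tc [OF Bc [OF ab(2)]]])
    then show "N $$ (a, b) = (mat_adjoint U * (M * U)) $$ (a, b)"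
      using ab by (simp add: N_def op_matrix_def)
  qed (simp_all add: N_def U_def op_matrix_def)
  have [simp]: "A * B \<in> carrier_mat ?n ?n"
    if "A \<in> carrier_mat ?n ?n" "B \<in> carrier_mat ?n ?n" for A B :: "complex mat"
    using that by (rule mult_carrier_mat)
  note assoc = assoc_mult_mat [of _ ?n ?n _ ?n _ ?n]
  have "mat_adjoint N = mat_adjoint U * (mat_adjoint M * U)"
    unfolding N by (simp add: mat_adjoint_mult [of _ ?n ?n _ ?n] mat_adjoint_adjoint assoc)
  then have "mat_adjoint N * N = mat_adjoint U * (mat_adjoint M * ((U * mat_adjoint U) * (M * U)))"
    using N by (simp add: assoc)
  also have "\<dots> = mat_adjoint U * (mat_adjoint M * M) * U"
    unfolding UU' by (simp add: left_mult_one_mat [of _ ?n ?n] assoc)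
  finally have "similar_mat (mat_adjoint N * N) (mat_adjoint M * M)"
    using UU UU' by (intro similar_matI [of _ _ "mat_adjoint U" U ?n]) auto
  then have "char_poly (mat_adjoint N * N) = char_poly (mat_adjoint M * M)"
    by (rule char_poly_similar)
  then show ?thesis
    unfolding op_singular_values_def singular_values_def M_def N_def by simp
qed

end

(*
  Write K_l = sum_i s_i u_i v_i^* (with s, u, v depending on l). The sum of the k largest singular
  values of T is sum_a <Y_a, T X_a> for matrices X_a, Y_a (a < k) that are orthonormal or zero, and
    tr (Y_a^* K_l X_a K_l^* ) = sum_{i,j} s_i s_j (v_i^* X_a v_j) conj (u_i^* Y_a u_j),
  so by AM-GM it suffices to bound sum_{l,i,j} s_i s_j A_ij with A_ij = sum_a |v_i^* X_a v_j|^2.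
  Let h_0 >= h_1 >= ... be the eigenvalues of W = sum_a X_a^* X_a; their sum is at most k. If P is the
  projection onto v_0, ..., v_{p-1}, then R = sum_a X_a^* P X_a satisfies R <= W and R <= p, so its
  j-th eigenvalue is at most min p h_j. Hence the sum of A over the rectangle i < p, j < q is at most
  sum_{j<q} min p h_j, which is the sum over that rectangle of the staircase weights
  w_ij = max 0 (min 1 (h_j - i)). Abel summation in both indices gives
  sum s_i s_j A_ij <= sum s_i s_j w_ij. The weights lie in [0, 1], have total at most k and do not
  depend on l, so the sum over l is at most the sum of the k largest entries.
*)
theory Submission
  imports Defs
begin

section \<open>Orthonormal families\<close>

text \<open>Vectors are functions restricted to an index set \<open>S\<close>, so that the same
  lemmas serve \<open>{..<d}\<close>, \<open>{..<d * d}\<close> and pairs of indices. On pairs this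
  is the Hilbert--Schmidt inner product.\<close>

definition cip :: "'i set \<Rightarrow> ('i \<Rightarrow> complex) \<Rightarrow> ('i \<Rightarrow> complex) \<Rightarrow> complex" where
  "cip S x y = (\<Sum>i\<in>S. cnj (x i) * y i)"

definition sqnorm :: "'i set \<Rightarrow> ('i \<Rightarrow> complex) \<Rightarrow> real" where
  "sqnorm S x = (\<Sum>i\<in>S. (cmod (x i))\<^sup>2)"

definition sub_orthonormal :: "'i set \<Rightarrow> nat \<Rightarrow> (nat \<Rightarrow> 'i \<Rightarrow> complex) \<Rightarrow> bool" where
  "sub_orthonormal S m u \<longleftrightarrow>
     (\<forall>a<m. \<forall>b<m. a \<noteq> b \<longrightarrow> cip S (u a) (u b) = 0) \<and> (\<forall>a<m. sqnorm S (u a) \<in> {0, 1})"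

definition orthonormal :: "'i set \<Rightarrow> nat \<Rightarrow> (nat \<Rightarrow> 'i \<Rightarrow> complex) \<Rightarrow> bool" where
  "orthonormal S m u \<longleftrightarrow> (\<forall>a<m. \<forall>b<m. cip S (u a) (u b) = (if a = b then 1 else 0))"

lemma cip_self: "cip S x x = complex_of_real (sqnorm S x)"
  by (simp add: cip_def sqnorm_def complex_norm_square mult.commute del: of_real_power)

lemma cip_commute: "cip S x y = cnj (cip S y x)"
  by (simp add: cip_def mult.commute)

lemma cip_diff_right: "cip S x (\<lambda>i. y i - z i) = cip S x y - cip S x z"
  by (simp add: cip_def algebra_simps sum_subtractf)

lemma cip_scale_right: "cip S x (\<lambda>i. c * y i) = c * cip S x y"
  by (simp add: cip_def sum_distrib_left mult_ac)

lemma cip_scale_left: "cip S (\<lambda>i. c * x i) y = cnj c * cip S x y"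
  by (simp add: cip_def sum_distrib_left mult_ac)

lemma cip_sum_right: "cip S x (\<lambda>i. \<Sum>r\<in>R. y r i) = (\<Sum>r\<in>R. cip S x (y r))"
  unfolding cip_def sum_distrib_left by (rule sum.swap)

lemma cip_sum_left: "cip S (\<lambda>i. \<Sum>r\<in>R. x r i) y = (\<Sum>r\<in>R. cip S (x r) y)"
  unfolding cip_def cnj_sum sum_distrib_right by (rule sum.swap)

lemma sqnorm_nonneg: "0 \<le> sqnorm S x"
  by (simp add: sqnorm_def sum_nonneg)

lemma sqnorm_diff:
  "sqnorm S (\<lambda>i. x i - y i) = sqnorm S x - 2 * Re (cip S x y) + sqnorm S y"
proof -
  have *: "(cmod (a - b))\<^sup>2 = (cmod a)\<^sup>2 - 2 * Re (cnj a * b) + (cmod b)\<^sup>2" for a b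
    unfolding cmod_power2 by (simp add: power2_eq_square algebra_simps)
  show ?thesis
    by (simp add: sqnorm_def cip_def * sum.distrib sum_subtractf sum_distrib_left)
qed

lemma sqnorm_scale: "sqnorm S (\<lambda>i. c * x i) = (cmod c)\<^sup>2 * sqnorm S x"
  by (simp add: sqnorm_def norm_mult power_mult_distrib sum_distrib_left)

lemma orthonormal_imp_sub_orthonormal:
  assumes "orthonormal S m u" shows "sub_orthonormal S m u"
proof -
  have "sqnorm S (u a) = 1" if "a < m" for a
    using assms that cip_self [of S "u a"] by (simp add: orthonormal_def)
  with assms show ?thesis by (simp add: orthonormal_def sub_orthonormal_def)
qed

lemma sub_orthonormal_mono: "sub_orthonormal S m u \<Longrightarrow> k \<le> m \<Longrightarrow> sub_orthonormal S k u"
  by (simp add: sub_orthonormal_def)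

text \<open>Induction by removing the component along the last vector: the remainder
  \<open>z\<close> has the same coefficients against the earlier vectors, and its squared norm drops
  by at least \<open>(cmod c)^2\<close>, whether \<open>u m\<close> is a unit vector or
  zero.\<close>

lemma bessel:
  assumes "sub_orthonormal S m u"
  shows "(\<Sum>a<m. (cmod (cip S (u a) y))\<^sup>2) \<le> sqnorm S y"
  using assms
proof (induction m arbitrary: y)
  case 0
  show ?case by (simp add: sqnorm_nonneg)
next
  case (Suc m)
  define c where "c = cip S (u m) y"
  define z where "z = (\<lambda>i. y i - c * u m i)"
  have orth: "cip S (u a) (u m) = 0" if "a < m" for a
    using Suc.prems that by (simp add: sub_orthonormal_def)
  have "(\<Sum>a<m. (cmod (cip S (u a) y))\<^sup>2) = (\<Sum>a<m. (cmod (cip S (u a) z))\<^sup>2)"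
    by (intro sum.cong) (simp_all add: z_def cip_diff_right cip_scale_right orth)
  also have "\<dots> \<le> sqnorm S z"
    using Suc.IH sub_orthonormal_mono [OF Suc.prems] by simp
  also have "\<dots> = sqnorm S y - 2 * Re (c * cip S y (u m)) + (cmod c)\<^sup>2 * sqnorm S (u m)"
    unfolding z_def sqnorm_diff cip_scale_right sqnorm_scale ..
  also have "c * cip S y (u m) = complex_of_real ((cmod c)\<^sup>2)"
    by (subst cip_commute) (simp add: c_def complex_norm_square del: of_real_power)
  also have "sqnorm S y - 2 * Re (complex_of_real ((cmod c)\<^sup>2)) + (cmod c)\<^sup>2 * sqnorm S (u m)
      \<le> sqnorm S y - (cmod c)\<^sup>2"
    using Suc.prems by (auto simp: sub_orthonormal_def)
  finally show ?case by (simp add: c_def)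
qed

text \<open>Pythagoras; equality can fail only because some \<open>u a\<close> may be zero.\<close>

lemma sqnorm_sum_sub_orthonormal_le:
  assumes "sub_orthonormal S m u"
  shows "sqnorm S (\<lambda>i. \<Sum>a<m. c a * u a i) \<le> (\<Sum>a<m. (cmod (c a))\<^sup>2)"
proof -
  have "complex_of_real (sqnorm S (\<lambda>i. \<Sum>a<m. c a * u a i)) =
      (\<Sum>a<m. \<Sum>b<m. cnj (c a) * (c b * cip S (u a) (u b)))"
    unfolding cip_self [symmetric] cip_sum_left cip_sum_right cip_scale_left cip_scale_right
    by (simp add: sum_distrib_left)
  also have "\<dots> = (\<Sum>a<m. complex_of_real ((cmod (c a))\<^sup>2 * sqnorm S (u a)))"
  proof (intro sum.cong refl)
    fix a assume a: "a \<in> {..<m}"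
    have "(\<Sum>b<m. cnj (c a) * (c b * cip S (u a) (u b))) =
        (\<Sum>b<m. if b = a then cnj (c a) * (c a * cip S (u a) (u a)) else 0)"
      using assms a by (intro sum.cong) (auto simp: sub_orthonormal_def)
    also have "\<dots> = complex_of_real ((cmod (c a))\<^sup>2 * sqnorm S (u a))"
      using a by (simp add: cip_self complex_norm_square mult_ac del: of_real_power)
    finally show "(\<Sum>b<m. cnj (c a) * (c b * cip S (u a) (u b))) =
        complex_of_real ((cmod (c a))\<^sup>2 * sqnorm S (u a))" .
  qed
  also have "\<dots> = complex_of_real (\<Sum>a<m. (cmod (c a))\<^sup>2 * sqnorm S (u a))"
    by simp
  finally have "sqnorm S (\<lambda>i. \<Sum>a<m. c a * u a i) = (\<Sum>a<m. (cmod (c a))\<^sup>2 * sqnorm S (u a))"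
    by (simp only: of_real_eq_iff)
  also have "\<dots> \<le> (\<Sum>a<m. (cmod (c a))\<^sup>2)"
    using assms by (intro sum_mono) (auto simp: sub_orthonormal_def)
  finally show ?thesis .
qed

text \<open>There are \<open>j\<close> equations in \<open>j + 1\<close> unknowns. A zero row makes
  the system square with determinant 0, which yields a nonzero kernel vector. This is the dimension
  count in the eigenvalue comparison below.\<close>

lemma homogeneous_system_nontrivial_solution:
  fixes G :: "nat \<Rightarrow> nat \<Rightarrow> complex"
  obtains c where "\<exists>r\<le>j. c r \<noteq> 0" "\<And>s. s < j \<Longrightarrow> (\<Sum>r\<le>j. G s r * c r) = 0"
proof -
  define M where "M = mat (Suc j) (Suc j) (\<lambda>(s, r). if s < j then G s r else 0)"
  have M: "M \<in> carrier_mat (Suc j) (Suc j)" by (simp add: M_def)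
  have zero_row: "M = mat\<^sub>r (Suc j) (Suc j) (\<lambda>i. if i = j then 0\<^sub>v (Suc j) else row M i)"
    by (intro eq_matI) (auto simp: M_def)
  have "det M = 0"
    by (subst zero_row, rule det_row_0) (auto simp: M_def)
  then obtain v where v: "v \<in> carrier_vec (Suc j)" "v \<noteq> 0\<^sub>v (Suc j)" "M *\<^sub>v v = 0\<^sub>v (Suc j)"
    using det_0_iff_vec_prod_zero [OF M] by auto
  have "\<exists>r\<le>j. v $ r \<noteq> 0"
  proof (rule ccontr)
    assume "\<not> ?thesis"
    then have "v = 0\<^sub>v (Suc j)" using v(1) by (intro eq_vecI) auto
    with v(2) show False by simp
  qed
  moreover have "(\<Sum>r\<le>j. G s r * v $ r) = 0" if "s < j" for s
  proof -
    have "(M *\<^sub>v v) $ s = (\<Sum>r\<le>j. G s r * v $ r)"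
      using that v(1) M by (simp add: M_def scalar_prod_def atLeast0LessThan lessThan_Suc_atMost)
    with v(3) that show ?thesis by simp
  qed
  ultimately show ?thesis by (rule that)
qed

section \<open>Spectral theorem and singular value decomposition\<close>

text \<open>Complete \<open>v\<close> to a basis, apply Gram--Schmidt, which keeps the first vector,
  and divide each column by its norm \<open>r i\<close>.\<close>

lemma unitary_with_first_column:
  fixes v :: "complex vec"
  assumes v: "v \<in> carrier_vec n" "v \<noteq> 0\<^sub>v n" and n: "n > 0"
  obtains W c where "W \<in> carrier_mat n n" "mat_adjoint W * W = 1\<^sub>m n" "col W 0 = c \<cdot>\<^sub>v v"
proof -
  interpret cof_vec_space n "TYPE(complex)" .
  define b where "b = basis_completion v"
  note bc = basis_completion [OF v, folded b_def]
  from bc(6,7) n obtain vs where bv: "b = v # vs" by (cases b) auto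
  define ws where "ws = gram_schmidt n b"
  from gram_schmidt_result [OF bc(2,4,5) ws_def]
  have ws: "set ws \<subseteq> carrier_vec n" "corthogonal ws" "length ws = n"
    by (auto simp: bc(6))
  have hd: "hd ws = v" unfolding ws_def bv by (rule gram_schmidt_hd [OF v(1)])
  have wc: "ws ! i \<in> carrier_vec n" if "i < n" for i using ws that by auto
  define r where "r i = sqrt (sqnorm {..<n} (\<lambda>a. ws ! i $ a))" for i
  have self: "ws ! i \<bullet>c ws ! j = cip {..<n} (\<lambda>a. ws ! j $ a) (\<lambda>a. ws ! i $ a)"
    if "i < n" "j < n" for i j
    using wc [OF that(1)] wc [OF that(2)]
    by (simp add: scalar_prod_def cip_def atLeast0LessThan mult.commute)
  have r: "complex_of_real (r i) * complex_of_real (r i) = ws ! i \<bullet>c ws ! i" "r i \<noteq> 0"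
    if "i < n" for i
  proof -
    have "r i * r i = sqnorm {..<n} (\<lambda>a. ws ! i $ a)"
      by (simp add: r_def sqnorm_nonneg)
    then show *: "complex_of_real (r i) * complex_of_real (r i) = ws ! i \<bullet>c ws ! i"
      unfolding self [OF that that] cip_self by (metis of_real_mult)
    have "ws ! i \<bullet>c ws ! i \<noteq> 0" using corthogonalD [OF ws(2), of i i] that ws(3) by simp
    with * show "r i \<noteq> 0" by auto
  qed
  define W where "W = mat n n (\<lambda>(a, i). ws ! i $ a / complex_of_real (r i))"
  show thesis
  proof (rule that [of W])
    show "W \<in> carrier_mat n n" by (simp add: W_def)
    show "mat_adjoint W * W = 1\<^sub>m n"
    proof (rule eq_matI)
      fix i j assume "i < dim_row (1\<^sub>m n :: complex mat)" "j < dim_col (1\<^sub>m n :: complex mat)"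
      then have ij: "i < n" "j < n" by auto
      have "(mat_adjoint W * W) $$ (i, j) =
          (ws ! j \<bullet>c ws ! i) / (complex_of_real (r i) * complex_of_real (r j))"
        unfolding self [OF ij(2,1)] using ij
        by (simp add: W_def scalar_prod_def atLeast0LessThan cip_def sum_divide_distrib)
      also have "\<dots> = (if i = j then 1 else 0)"
        using r [OF ij(1)] corthogonalD [OF ws(2), of j i] ij ws(3) by auto
      finally show "(mat_adjoint W * W) $$ (i, j) = 1\<^sub>m n $$ (i, j)" using ij by simp
    qed (auto simp: W_def)
    have "ws ! 0 = v" using hd ws(3) n by (cases ws) auto
    then show "col W 0 = (1 / complex_of_real (r 0)) \<cdot>\<^sub>v v"
      using v(1) n by (intro eq_vecI) (auto simp: W_def)
  qed
qed

text \<open>Deflation: in a unitary basis starting with an eigenvector, the first column of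
  \<open>A\<close> vanishes below the diagonal, and by symmetry so does the rest of the first row.
  The induction hypothesis diagonalises the remaining block.\<close>

lemma hermitian_spectral_matrix:
  assumes "A \<in> carrier_mat n n" "mat_adjoint A = A"
  shows "\<exists>U h. U \<in> carrier_mat n n \<and> mat_adjoint U * U = 1\<^sub>m n \<and>
    A = U * (mat n n (\<lambda>(i, j). if i = j then complex_of_real (h i) else 0) * mat_adjoint U)"
  using assms
proof (induction n arbitrary: A)
  case 0
  then show ?case by (intro exI [of _ "1\<^sub>m 0"]) (auto intro!: eq_matI)
next
  case (Suc n)
  let ?n = "Suc n"
  note A = Suc.prems(1)
  have herm: "A $$ (i, j) = cnj (A $$ (j, i))" if "i < ?n" "j < ?n" for i j
    using index_mat_adjoint [of i A j] Suc.prems that by simp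
  have "degree (char_poly A) > 0" using degree_monic_char_poly [OF A] by simp
  then obtain e where "poly (char_poly A) e = 0"
    using alg_closed_imp_poly_has_root by blast
  then obtain v where "eigenvector A v e"
    using eigenvalue_root_char_poly [OF A] unfolding eigenvalue_def by blast
  then have v: "v \<in> carrier_vec ?n" "v \<noteq> 0\<^sub>v ?n" "A *\<^sub>v v = e \<cdot>\<^sub>v v"
    using A by (auto simp: eigenvector_def)
  obtain W c where W: "W \<in> carrier_mat ?n ?n" "mat_adjoint W * W = 1\<^sub>m ?n"
    and col: "col W 0 = c \<cdot>\<^sub>v v"
    using unitary_with_first_column [OF v(1,2)] by blast
  have W': "W * mat_adjoint W = 1\<^sub>m ?n"
    by (rule mat_mult_left_right_inverse [OF _ W(1) W(2)]) (use W in simp)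
  note assoc = assoc_mult_mat [of _ ?n ?n _ ?n _ ?n]
  have mc [simp]: "X * Y \<in> carrier_mat ?n ?n"
    if "X \<in> carrier_mat ?n ?n" "Y \<in> carrier_mat ?n ?n" for X Y :: "complex mat"
    using that by (rule mult_carrier_mat)
  define B where "B = mat_adjoint W * (A * W)"
  have [simp]: "B \<in> carrier_mat ?n ?n" "A \<in> carrier_mat ?n ?n" "W \<in> carrier_mat ?n ?n"
    using A W by (simp_all add: B_def)
  have AB: "A = W * (B * mat_adjoint W)"
  proof -
    have "W * (B * mat_adjoint W) = (W * mat_adjoint W) * A * (W * mat_adjoint W)"
      by (simp add: B_def assoc)
    then show ?thesis by (simp add: W' left_mult_one_mat [OF A] right_mult_one_mat [OF A])
  qed
  have Bh: "mat_adjoint B = B"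
    unfolding B_def using Suc.prems(2)
    by (simp add: mat_adjoint_mult [of _ ?n ?n _ ?n] mat_adjoint_adjoint assoc)
  have Bherm: "B $$ (i, j) = cnj (B $$ (j, i))" if "i < ?n" "j < ?n" for i j
    using index_mat_adjoint [of i B j] Bh that carrier_matD [OF \<open>B \<in> carrier_mat ?n ?n\<close>] by simp
  \<comment> \<open>The first column of \<open>W\<close> is a multiple of \<open>v\<close>, hence an
    eigenvector, so the first column of \<open>B\<close> is \<open>e\<close> times that of
    \<open>mat_adjoint W * W\<close>.\<close>
  have B0: "B $$ (i, 0) = (if i = 0 then e else 0)" if "i < ?n" for i
  proof -
    have "A *\<^sub>v col W 0 = c \<cdot>\<^sub>v (e \<cdot>\<^sub>v v)"
      unfolding col mult_mat_vec [OF A v(1)] v(3) ..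
    also have "\<dots> = e \<cdot>\<^sub>v col W 0" unfolding col by (auto simp: smult_smult_assoc mult.commute)
    finally have "col (A * W) 0 = e \<cdot>\<^sub>v col W 0"
      by (subst col_mult2 [OF A W(1)]) auto
    then have "B $$ (i, 0) = row (mat_adjoint W) i \<bullet> (e \<cdot>\<^sub>v col W 0)"
      unfolding B_def using that carrier_matD [OF A] carrier_matD [OF W(1)] by simp
    also have "\<dots> = e * (mat_adjoint W * W) $$ (i, 0)"
      using that carrier_matD [OF W(1)] by simp
    finally show ?thesis using that by (simp add: W(2))
  qed
  define B' where "B' = mat n n (\<lambda>(i, j). B $$ (Suc i, Suc j))"
  have "B' \<in> carrier_mat n n" "mat_adjoint B' = B'"
    unfolding B'_def by (auto intro!: eq_matI simp: Bherm [symmetric])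
  then obtain V h where V: "V \<in> carrier_mat n n" "mat_adjoint V * V = 1\<^sub>m n"
    and B': "B' = V * (mat n n (\<lambda>(i, j). if i = j then complex_of_real (h i) else 0) * mat_adjoint V)"
    using Suc.IH by blast
  define h' where "h' i = (case i of 0 \<Rightarrow> Re e | Suc i \<Rightarrow> h i)" for i
  \<comment> \<open>Block diagonal: 1 in the corner and \<open>V\<close> in the remaining
    block.\<close>
  define V' where "V' = mat ?n ?n (\<lambda>(i, j). case (i, j) of (Suc i, Suc j) \<Rightarrow> V $$ (i, j)
     | (0, 0) \<Rightarrow> 1 | _ \<Rightarrow> 0)"
  let ?D = "\<lambda>n h. mat n n (\<lambda>(i, j). if i = j then complex_of_real (h i) else 0)"
  have [simp]: "V' \<in> carrier_mat ?n ?n" "?D ?n h' \<in> carrier_mat ?n ?n" by (simp_all add: V'_def)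
  have Ve: "(\<Sum>k<n. cnj (V $$ (k, i)) * V $$ (k, j)) = (if i = j then 1 else 0)"
    if "i < n" "j < n" for i j
  proof -
    have "(mat_adjoint V * V) $$ (i, j) = (\<Sum>k<n. cnj (V $$ (k, i)) * V $$ (k, j))"
      using V(1) that by (simp add: scalar_prod_def atLeast0LessThan)
    then show ?thesis using V(2) that by simp
  qed
  have UDU: "(X * (?D k g * mat_adjoint X)) $$ (i, j) =
      (\<Sum>r<k. X $$ (i, r) * (complex_of_real (g r) * cnj (X $$ (j, r))))"
    if X: "X \<in> carrier_mat k k" and ij: "i < k" "j < k" for X k g i j
  proof -
    have "(\<Sum>s<k. (if r = s then complex_of_real (g r) else 0) * cnj (X $$ (j, s))) =
        complex_of_real (g r) * cnj (X $$ (j, r))" if "r < k" for r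
      using that by (simp add: if_distrib [of "\<lambda>x. x * _"] cong: if_cong)
    then show ?thesis using X ij by (simp add: scalar_prod_def atLeast0LessThan)
  qed
  have V'V': "mat_adjoint V' * V' = 1\<^sub>m ?n"
  proof (rule eq_matI)
    fix i j assume "i < dim_row (1\<^sub>m ?n :: complex mat)" "j < dim_col (1\<^sub>m ?n :: complex mat)"
    then show "(mat_adjoint V' * V') $$ (i, j) = 1\<^sub>m ?n $$ (i, j)"
      by (cases i; cases j)
        (simp_all add: V'_def scalar_prod_def atLeast0LessThan sum.lessThan_Suc_shift Ve del: sum.lessThan_Suc)
  qed (simp_all add: V'_def)
  \<comment> \<open>The eigenvalue is real, being a diagonal entry of the Hermitian matrix
    \<open>B\<close>; hence \<open>h'\<close> may store \<open>Re e\<close>.\<close>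
  have e: "complex_of_real (Re e) = e"
    using Bherm [of 0 0] B0 [of 0] by (simp add: complex_eq_iff)
  have BV: "B = V' * (?D ?n h' * mat_adjoint V')"
  proof (rule eq_matI)
    fix i j
    assume "i < dim_row (V' * (?D ?n h' * mat_adjoint V'))" "j < dim_col (V' * (?D ?n h' * mat_adjoint V'))"
    then have ij: "i < ?n" "j < ?n" by (simp_all add: V'_def)
    have B0j: "B $$ (0, j) = 0" if "0 < j" "j < ?n" for j
      using Bherm [of 0 j] B0 [of j] that by simp
    have BSuc: "B $$ (Suc i, Suc j) = (\<Sum>r<n. V $$ (i, r) * (complex_of_real (h r) * cnj (V $$ (j, r))))"
      if "i < n" "j < n" for i j
      using UDU [OF V(1) that, of h] that unfolding B' [symmetric] by (simp add: B'_def)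
    show "B $$ (i, j) = (V' * (?D ?n h' * mat_adjoint V')) $$ (i, j)"
      unfolding UDU [OF \<open>V' \<in> carrier_mat ?n ?n\<close> ij] using ij B0 [of i] B0j [of j] BSuc
      by (cases i; cases j)
        (simp_all add: V'_def h'_def e sum.lessThan_Suc_shift del: sum.lessThan_Suc)
  qed (simp_all add: V'_def B_def carrier_matD [OF W(1)])
  have "mat_adjoint (W * V') * (W * V') = mat_adjoint V' * ((mat_adjoint W * W) * V')"
    by (simp add: mat_adjoint_mult [of _ ?n ?n _ ?n] assoc carrier_matD [OF W(1)])
  then have 1: "mat_adjoint (W * V') * (W * V') = 1\<^sub>m ?n"
    by (simp add: W V'V' left_mult_one_mat [of _ ?n ?n])
  have 2: "A = (W * V') * (?D ?n h' * mat_adjoint (W * V'))"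
    by (subst AB, subst BV) (simp add: mat_adjoint_mult [of _ ?n ?n _ ?n] assoc)
  show ?case by (intro exI [of _ "W * V'"] exI [of _ h'] conjI 1 2) simp
qed

lemma decreasing_permutation:
  fixes h :: "nat \<Rightarrow> real"
  shows "\<exists>\<pi>. bij_betw \<pi> {..<n} {..<n} \<and> (\<forall>i j. i \<le> j \<longrightarrow> j < n \<longrightarrow> h (\<pi> j) \<le> h (\<pi> i))"
proof -
  define xs where "xs = sort_key (\<lambda>i. - h i) [0..<n]"
  have len: "length xs = n" "distinct xs" "set xs = {..<n}" by (auto simp: xs_def)
  have sorted: "sorted (map (\<lambda>i. - h i) xs)" by (simp add: xs_def)
  show ?thesis
  proof (intro exI [of _ "\<lambda>i. xs ! i"] conjI allI impI)
    show "bij_betw (\<lambda>i. xs ! i) {..<n} {..<n}"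
      by (rule bij_betw_nth [OF len(2)]) (simp_all only: len)
    show "h (xs ! j) \<le> h (xs ! i)" if "i \<le> j" "j < n" for i j
      using sorted_nth_mono [OF sorted, of i j] that len(1) by simp
  qed
qed

lemma sum_mult_delta:
  fixes f :: "nat \<Rightarrow> complex"
  assumes "i < n"
  shows "(\<Sum>j<n. f j * (if i = j then 1 else 0)) = f i"
  using assms by (simp add: if_distrib [of "\<lambda>x. _ * x"] cong: if_cong)

text \<open>The vector \<open>e r\<close> is the eigenvector for \<open>h r\<close>. The fourth
  conjunct is the resolution of the identity; the last one records algebraic multiplicities, which
  \<open>singular_values\<close> refers to.\<close>

definition eigen_expansion ::
    "nat \<Rightarrow> (nat \<Rightarrow> nat \<Rightarrow> complex) \<Rightarrow> (nat \<Rightarrow> nat \<Rightarrow> complex) \<Rightarrow> (nat \<Rightarrow> real) \<Rightarrow> bool" where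
  "eigen_expansion n A e h \<longleftrightarrow>
     orthonormal {..<n} n e \<and>
     (\<forall>i j. i \<le> j \<longrightarrow> j < n \<longrightarrow> h j \<le> h i) \<and>
     (\<forall>i<n. \<forall>j<n. A i j = (\<Sum>r<n. of_real (h r) * (e r i * cnj (e r j)))) \<and>
     (\<forall>i<n. \<forall>j<n. (\<Sum>r<n. e r i * cnj (e r j)) = (if i = j then 1 else 0)) \<and>
     char_poly (mat n n (\<lambda>(i, j). A i j)) = (\<Prod>r<n. [:- of_real (h r), 1:])"

text \<open>The columns of the diagonalising unitary, permuted so that the eigenvalues decrease.
  Completeness is \<open>U * mat_adjoint U = 1\<close>, and the characteristic polynomial comes from
  similarity to the diagonal matrix.\<close>

lemma hermitian_spectral:
  fixes A :: "nat \<Rightarrow> nat \<Rightarrow> complex"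
  assumes "\<And>i j. i < n \<Longrightarrow> j < n \<Longrightarrow> A i j = cnj (A j i)"
  obtains e h where "eigen_expansion n A e h"
proof -
  define M where "M = mat n n (\<lambda>(i, j). A i j)"
  have M: "M \<in> carrier_mat n n" by (simp add: M_def)
  have "mat_adjoint M = M" by (intro eq_matI) (simp_all add: M_def assms [symmetric])
  then obtain U h where U: "U \<in> carrier_mat n n" "mat_adjoint U * U = 1\<^sub>m n"
    and MU: "M = U * (mat n n (\<lambda>(i, j). if i = j then complex_of_real (h i) else 0) * mat_adjoint U)"
      (is "_ = U * (?D * _)")
    using hermitian_spectral_matrix [OF M] by blast
  have UU: "U * mat_adjoint U = 1\<^sub>m n"
    by (rule mat_mult_left_right_inverse [OF _ U(1) U(2)]) (use U in simp)
  obtain \<pi> where \<pi>: "bij_betw \<pi> {..<n} {..<n}"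
    and dec: "\<forall>i j. i \<le> j \<longrightarrow> j < n \<longrightarrow> h (\<pi> j) \<le> h (\<pi> i)"
    using decreasing_permutation [of n h] by auto
  have \<pi>n: "\<pi> r < n" if "r < n" for r using bij_betwE [OF \<pi>] that by auto
  have reindex: "(\<Sum>r<n. f (\<pi> r)) = (\<Sum>r<n. f r)" for f :: "nat \<Rightarrow> complex"
    by (rule sum.reindex_bij_betw [OF \<pi>])
  have ortho: "(\<Sum>k<n. cnj (U $$ (k, i)) * U $$ (k, j)) = (if i = j then 1 else 0)"
    if "i < n" "j < n" for i j
  proof -
    have "(mat_adjoint U * U) $$ (i, j) = (\<Sum>k<n. cnj (U $$ (k, i)) * U $$ (k, j))"
      using U(1) that by (simp add: scalar_prod_def atLeast0LessThan)
    then show ?thesis using U(2) that by simp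
  qed
  have complete: "(\<Sum>k<n. U $$ (i, k) * cnj (U $$ (j, k))) = (if i = j then 1 else 0)"
    if "i < n" "j < n" for i j
  proof -
    have "(U * mat_adjoint U) $$ (i, j) = (\<Sum>k<n. U $$ (i, k) * cnj (U $$ (j, k)))"
      using U(1) that by (simp add: scalar_prod_def atLeast0LessThan)
    then show ?thesis using UU that by simp
  qed
  have expand: "A i j = (\<Sum>r<n. of_real (h r) * (U $$ (i, r) * cnj (U $$ (j, r))))"
    if ij: "i < n" "j < n" for i j
  proof -
    have "(\<Sum>s<n. (if r = s then complex_of_real (h r) else 0) * cnj (U $$ (j, s))) =
        complex_of_real (h r) * cnj (U $$ (j, r))" if "r < n" for r
      using that by (simp add: if_distrib [of "\<lambda>x. x * _"] cong: if_cong)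
    then have "M $$ (i, j) = (\<Sum>r<n. U $$ (i, r) * (complex_of_real (h r) * cnj (U $$ (j, r))))"
      unfolding MU using U(1) ij by (simp add: scalar_prod_def atLeast0LessThan)
    then show ?thesis using ij by (simp add: M_def mult_ac)
  qed
  have "similar_mat M ?D"
    using U UU M MU by (intro similar_matI [of _ _ U "mat_adjoint U" n]) (auto simp: assoc_mult_mat [of _ n n _ n _ n])
  then have "char_poly M = char_poly ?D" by (rule char_poly_similar)
  also have "\<dots> = (\<Prod>a\<leftarrow>diag_mat ?D. [:- a, 1:])"
    by (rule char_poly_upper_triangular [of _ n]) auto
  also have "diag_mat ?D = map (\<lambda>i. complex_of_real (h i)) [0..<n]"
    by (simp add: diag_mat_def)
  also have "(\<Prod>a\<leftarrow>map (\<lambda>i. complex_of_real (h i)) [0..<n]. [:- a, 1:]) = (\<Prod>r<n. [:- complex_of_real (h r), 1:])"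
    using prod.distinct_set_conv_list [of "[0..<n]" "\<lambda>r. [:- complex_of_real (h r), 1:]"]
    by (simp add: o_def atLeast0LessThan)
  also have "\<dots> = (\<Prod>r<n. [:- complex_of_real (h (\<pi> r)), 1:])"
    by (rule prod.reindex_bij_betw [OF \<pi>, symmetric])
  finally have cp: "char_poly M = (\<Prod>r<n. [:- complex_of_real (h (\<pi> r)), 1:])" .
  show thesis
  proof (rule that [of "\<lambda>r i. U $$ (i, \<pi> r)" "h \<circ> \<pi>"], unfold eigen_expansion_def, intro conjI allI impI)
    show "orthonormal {..<n} n (\<lambda>r i. U $$ (i, \<pi> r))"
      using bij_betw_imp_inj_on [OF \<pi>]
      by (auto simp: orthonormal_def cip_def ortho \<pi>n inj_on_eq_iff)
    show "A i j = (\<Sum>r<n. of_real ((h \<circ> \<pi>) r) * (U $$ (i, \<pi> r) * cnj (U $$ (j, \<pi> r))))"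
      if "i < n" "j < n" for i j
      unfolding expand [OF that] o_def by (rule reindex [symmetric])
    show "(\<Sum>r<n. U $$ (i, \<pi> r) * cnj (U $$ (j, \<pi> r))) = (if i = j then 1 else 0)"
      if "i < n" "j < n" for i j
      unfolding complete [OF that, symmetric] by (rule reindex)
    show "(h \<circ> \<pi>) j \<le> (h \<circ> \<pi>) i" if "i \<le> j" "j < n" for i j
      using dec that by simp
    show "char_poly (mat n n (\<lambda>(i, j). A i j)) = (\<Prod>r<n. [:- of_real ((h \<circ> \<pi>) r), 1:])"
      using cp by (simp add: M_def)
  qed
qed

section \<open>Singular value decomposition\<close>

text \<open>The roots with multiplicity are the \<open>h r\<close>, and their square roots are
  already in decreasing order, so sorting and reversing in \<open>singular_values\<close> returns
  the same list.\<close>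

lemma singular_values_eqI:
  assumes cp: "char_poly (mat_adjoint A * A) = (\<Prod>r<n. [:- complex_of_real (h r), 1:])"
    and dec: "\<And>i j. i \<le> j \<Longrightarrow> j < n \<Longrightarrow> h j \<le> h i"
  shows "singular_values A = vec n (\<lambda>i. sqrt (h i))"
proof -
  define xs where "xs = map (\<lambda>i. sqrt (h i)) [0..<n]"
  have "proots (\<Prod>r<k. [:- complex_of_real (h r), 1:]) =
      mset (map (\<lambda>r. complex_of_real (h r)) [0..<k])" for k
  proof (induction k)
    case (Suc k)
    have "proots ((\<Prod>r<k. [:- complex_of_real (h r), 1:]) * [:- complex_of_real (h k), 1:]) =
        proots (\<Prod>r<k. [:- complex_of_real (h r), 1:]) + proots [:- complex_of_real (h k), 1:]"
      by (rule proots_mult) (auto simp: prod_zero_iff)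
    with Suc show ?case by (simp add: mult.commute)
  qed simp
  then have "image_mset (\<lambda>z. sqrt (Re z)) (proots (char_poly (mat_adjoint A * A))) = mset xs"
    unfolding cp by (simp only: xs_def mset_map [symmetric] map_map o_def Re_complex_of_real)
  moreover have "rev (sorted_list_of_multiset (mset xs)) = xs"
  proof -
    have "sorted (rev xs)"
      unfolding sorted_iff_nth_mono using dec by (simp add: xs_def rev_nth)
    then have "sort xs = rev xs" by (intro properties_for_sort) simp_all
    then show ?thesis by (simp add: sorted_list_of_multiset_mset)
  qed
  ultimately have "singular_values A = vec_of_list xs" by (simp add: singular_values_def)
  also have "\<dots> = vec n (\<lambda>i. sqrt (h i))" by (intro eq_vecI) (auto simp: xs_def vec_of_list_index)
  finally show ?thesis .
qed

text \<open>The clause \<open>s r * sqnorm {..<n} (u r) = s r\<close> forces \<open>u r\<close> to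
  be a unit vector whenever \<open>s r\<close> is nonzero.\<close>

definition svd ::
    "nat \<Rightarrow> complex mat \<Rightarrow> (nat \<Rightarrow> real) \<Rightarrow> (nat \<Rightarrow> nat \<Rightarrow> complex) \<Rightarrow> (nat \<Rightarrow> nat \<Rightarrow> complex) \<Rightarrow> bool" where
  "svd n A s u v \<longleftrightarrow>
     (\<forall>i<n. singular_values A $ i = s i) \<and> (\<forall>i<n. 0 \<le> s i) \<and>
     (\<forall>i j. i \<le> j \<longrightarrow> j < n \<longrightarrow> s j \<le> s i) \<and>
     orthonormal {..<n} n v \<and> sub_orthonormal {..<n} n u \<and>
     (\<forall>r<n. s r * sqnorm {..<n} (u r) = s r) \<and>
     (\<forall>i<n. \<forall>j<n. A $$ (i, j) = (\<Sum>r<n. of_real (s r) * (u r i * cnj (v r j))))"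

text \<open>Eigenvectors of \<open>mat_adjoint A * A\<close> serve as right singular vectors. Their
  images \<open>w r\<close> are orthogonal with squared norm \<open>h r\<close>, and completeness of
  the eigenvectors recovers \<open>A\<close> from these images.\<close>

lemma singular_value_decomposition:
  assumes A: "A \<in> carrier_mat n n"
  obtains s u v where "svd n A s u v"
proof -
  define G where "G i j = (\<Sum>k<n. cnj (A $$ (k, i)) * A $$ (k, j))" for i j
  have G: "G i j = cnj (G j i)" for i j by (simp add: G_def mult.commute)
  have AA: "mat_adjoint A * A = mat n n (\<lambda>(i, j). G i j)"
    using A by (intro eq_matI) (auto simp: G_def scalar_prod_def atLeast0LessThan)
  obtain e h where "eigen_expansion n G e h"
    by (rule hermitian_spectral [of n G, OF G])
  then have e: "orthonormal {..<n} n e"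
    and h: "\<And>i j. i \<le> j \<Longrightarrow> j < n \<Longrightarrow> h j \<le> h i"
    and Ge: "\<And>i j. i < n \<Longrightarrow> j < n \<Longrightarrow> G i j = (\<Sum>r<n. of_real (h r) * (e r i * cnj (e r j)))"
    and compl: "\<And>i j. i < n \<Longrightarrow> j < n \<Longrightarrow> (\<Sum>r<n. e r i * cnj (e r j)) = (if i = j then 1 else 0)"
    and cp: "char_poly (mat n n (\<lambda>(i, j). G i j)) = (\<Prod>r<n. [:- of_real (h r), 1:])"
    by (auto simp: eigen_expansion_def)
  define w where "w r i = (\<Sum>j<n. A $$ (i, j) * e r j)" for r i
  have w: "cip {..<n} (w a) (w b) = (if a = b then of_real (h a) else 0)" if ab: "a < n" "b < n" for a b
  proof -
    have "cip {..<n} (w a) (w b) = (\<Sum>k<n. \<Sum>i<n. \<Sum>j<n. cnj (e a i) * ((cnj (A $$ (k, i)) * A $$ (k, j)) * e b j))"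
      unfolding cip_def w_def cnj_sum sum_product by (intro sum.cong refl) (simp add: mult_ac)
    also have "\<dots> = (\<Sum>i<n. \<Sum>k<n. \<Sum>j<n. cnj (e a i) * ((cnj (A $$ (k, i)) * A $$ (k, j)) * e b j))"
      by (rule sum.swap)
    also have "\<dots> = (\<Sum>i<n. \<Sum>j<n. cnj (e a i) * (G i j * e b j))"
      unfolding G_def sum_distrib_left sum_distrib_right by (intro sum.cong refl sum.swap)
    also have "\<dots> = (\<Sum>i<n. \<Sum>j<n. \<Sum>r<n. of_real (h r) * ((cnj (e a i) * e r i) * (cnj (e r j) * e b j)))"
      by (intro sum.cong refl) (simp add: Ge sum_distrib_left sum_distrib_right mult_ac)
    also have "\<dots> = (\<Sum>i<n. \<Sum>r<n. \<Sum>j<n. of_real (h r) * ((cnj (e a i) * e r i) * (cnj (e r j) * e b j)))"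
      by (intro sum.cong refl sum.swap)
    also have "\<dots> = (\<Sum>r<n. \<Sum>i<n. \<Sum>j<n. of_real (h r) * ((cnj (e a i) * e r i) * (cnj (e r j) * e b j)))"
      by (rule sum.swap)
    also have "\<dots> = (\<Sum>r<n. of_real (h r) * (cip {..<n} (e a) (e r) * cip {..<n} (e r) (e b)))"
      unfolding cip_def sum_product unfolding sum_distrib_left ..
    also have "\<dots> = (\<Sum>r<n. (of_real (h r) * cip {..<n} (e r) (e b)) * (if a = r then 1 else 0))"
      using e ab by (intro sum.cong) (auto simp: orthonormal_def)
    also have "\<dots> = (if a = b then of_real (h a) else 0)"
      using e ab by (subst sum_mult_delta) (auto simp: orthonormal_def)
    finally show ?thesis .
  qed
  have sq: "sqnorm {..<n} (w r) = h r" if "r < n" for r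
    using w [OF that that] by (simp add: cip_self)
  have h0: "0 \<le> h r" if "r < n" for r
    using sq [OF that] sqnorm_nonneg [of "{..<n}" "w r"] by simp
  \<comment> \<open>If \<open>h r = 0\<close>, division by zero makes \<open>u r\<close> the zero
    vector, as \<open>sub_orthonormal\<close> permits.\<close>
  define u where "u r i = w r i / complex_of_real (sqrt (h r))" for r i
  have u: "u r = (\<lambda>i. complex_of_real (1 / sqrt (h r)) * w r i)" for r
    by (auto simp: u_def fun_eq_iff)
  \<comment> \<open>In the degenerate case \<open>w r\<close> has norm 0, so both sides
    vanish.\<close>
  have uw: "of_real (sqrt (h r)) * u r i = w r i" if "r < n" "i < n" for r i
  proof (cases "h r = 0")
    case True
    then have "(\<Sum>i<n. (cmod (w r i))\<^sup>2) = 0"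
      using sq [OF that(1)] by (simp add: sqnorm_def)
    with True that show ?thesis by (simp add: sum_nonneg_eq_0_iff)
  qed (simp add: u_def)
  have squ: "sqnorm {..<n} (u r) = (if h r = 0 then 0 else 1)" if "r < n" for r
    unfolding u sqnorm_scale sq [OF that] norm_of_real using h0 [OF that]
    by (simp add: power_divide)
  show thesis
  proof (rule that [of "\<lambda>r. sqrt (h r)" u e], unfold svd_def, intro conjI allI impI)
    show "singular_values A $ i = sqrt (h i)" if "i < n" for i
      using singular_values_eqI [of A h n] cp h that by (simp add: AA)
    show "sub_orthonormal {..<n} n u"
    proof -
      have "cip {..<n} (u a) (u b) = 0" if "a < n" "b < n" "a \<noteq> b" for a b
        unfolding u cip_scale_left cip_scale_right using that by (simp add: w)
      then show ?thesis unfolding sub_orthonormal_def using squ by simp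
    qed
    show "A $$ (i, j) = (\<Sum>r<n. of_real (sqrt (h r)) * (u r i * cnj (e r j)))"
      if ij: "i < n" "j < n" for i j
    proof -
      have "(\<Sum>r<n. of_real (sqrt (h r)) * (u r i * cnj (e r j))) = (\<Sum>r<n. w r i * cnj (e r j))"
        using ij by (intro sum.cong) (simp_all add: mult.assoc [symmetric] uw)
      also have "\<dots> = (\<Sum>r<n. \<Sum>k<n. A $$ (i, k) * (e r k * cnj (e r j)))"
        by (simp add: w_def sum_distrib_right mult.assoc)
      also have "\<dots> = (\<Sum>k<n. A $$ (i, k) * (\<Sum>r<n. e r k * cnj (e r j)))"
        unfolding sum_distrib_left by (rule sum.swap)
      also have "\<dots> = (\<Sum>k<n. A $$ (i, k) * (if j = k then 1 else 0))"
        using ij by (intro sum.cong) (auto simp: compl)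
      also have "\<dots> = A $$ (i, j)" using ij by (rule_tac sum_mult_delta)
      finally show ?thesis ..
    qed
    show "sqrt (h r) * sqnorm {..<n} (u r) = sqrt (h r)" if "r < n" for r
      using squ [OF that] by simp
  qed (use e h h0 in auto)
qed

section \<open>The staircase bound\<close>

lemma spectral_quadratic_form:
  fixes A :: "nat \<Rightarrow> nat \<Rightarrow> complex"
  assumes "\<And>i j. i < n \<Longrightarrow> j < n \<Longrightarrow> A i j = (\<Sum>r<n. of_real (h r) * (e r i * cnj (e r j)))"
  shows "(\<Sum>i<n. \<Sum>j<n. cnj (x i) * A i j * x j) =
    complex_of_real (\<Sum>r<n. h r * (cmod (cip {..<n} (e r) x))\<^sup>2)"
proof -
  have "(\<Sum>i<n. \<Sum>j<n. cnj (x i) * A i j * x j) =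
      (\<Sum>i<n. \<Sum>j<n. \<Sum>r<n. of_real (h r) * ((cnj (x i) * e r i) * (cnj (e r j) * x j)))"
    by (intro sum.cong refl) (simp add: assms sum_distrib_left sum_distrib_right mult_ac)
  also have "\<dots> = (\<Sum>i<n. \<Sum>r<n. \<Sum>j<n. of_real (h r) * ((cnj (x i) * e r i) * (cnj (e r j) * x j)))"
    by (intro sum.cong refl sum.swap)
  also have "\<dots> = (\<Sum>r<n. \<Sum>i<n. \<Sum>j<n. of_real (h r) * ((cnj (x i) * e r i) * (cnj (e r j) * x j)))"
    by (rule sum.swap)
  also have "\<dots> = (\<Sum>r<n. of_real (h r) * (cip {..<n} x (e r) * cip {..<n} (e r) x))"
    unfolding cip_def sum_product unfolding sum_distrib_left ..
  also have "\<dots> = (\<Sum>r<n. complex_of_real (h r * (cmod (cip {..<n} (e r) x))\<^sup>2))"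
    by (intro sum.cong refl, subst (1) cip_commute)
      (simp add: complex_norm_square mult.commute del: of_real_power)
  finally show ?thesis by simp
qed

lemma spectral_trace:
  fixes A :: "nat \<Rightarrow> nat \<Rightarrow> complex"
  assumes "\<And>i j. i < n \<Longrightarrow> j < n \<Longrightarrow> A i j = (\<Sum>r<n. of_real (h r) * (e r i * cnj (e r j)))"
    and "orthonormal {..<n} n e"
  shows "(\<Sum>i<n. A i i) = complex_of_real (\<Sum>r<n. h r)"
proof -
  have "(\<Sum>i<n. A i i) = (\<Sum>i<n. \<Sum>r<n. of_real (h r) * (cnj (e r i) * e r i))"
    by (simp add: assms(1) mult.commute)
  also have "\<dots> = (\<Sum>r<n. of_real (h r) * cip {..<n} (e r) (e r))"
    unfolding cip_def sum_distrib_left by (rule sum.swap)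
  also have "\<dots> = (\<Sum>r<n. of_real (h r))"
    using assms(2) by (intro sum.cong) (auto simp: orthonormal_def)
  finally show ?thesis by simp
qed

lemma gram_quadratic_form:
  fixes g :: "'b \<Rightarrow> nat \<Rightarrow> complex"
  shows "(\<Sum>i<n. \<Sum>j<n. cnj (x i) * (\<Sum>b\<in>B. cnj (g b i) * g b j) * x j) =
    complex_of_real (\<Sum>b\<in>B. (cmod (\<Sum>j<n. g b j * x j))\<^sup>2)"
proof -
  have "(\<Sum>i<n. \<Sum>j<n. cnj (x i) * (\<Sum>b\<in>B. cnj (g b i) * g b j) * x j) =
      (\<Sum>i<n. \<Sum>j<n. \<Sum>b\<in>B. cnj (g b i * x i) * (g b j * x j))"
    by (simp add: sum_distrib_left sum_distrib_right mult_ac)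
  also have "\<dots> = (\<Sum>i<n. \<Sum>b\<in>B. \<Sum>j<n. cnj (g b i * x i) * (g b j * x j))"
    by (intro sum.cong refl sum.swap)
  also have "\<dots> = (\<Sum>b\<in>B. \<Sum>i<n. \<Sum>j<n. cnj (g b i * x i) * (g b j * x j))"
    by (rule sum.swap)
  also have "\<dots> = (\<Sum>b\<in>B. cnj (\<Sum>i<n. g b i * x i) * (\<Sum>j<n. g b j * x j))"
    by (simp add: sum_product)
  also have "\<dots> = complex_of_real (\<Sum>b\<in>B. (cmod (\<Sum>j<n. g b j * x j))\<^sup>2)"
    unfolding of_real_sum complex_norm_square by (simp only: mult.commute)
  finally show ?thesis .
qed

text \<open>
  Weyl monotonicity: on the span of the \<open>v j\<close> the \<open>j\<close>-th eigenvalue of the positive form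
  \<open>\<theta>[f] = \<Sum>b. \<bar>L b \<cdot> f\<bar>\<^sup>2\<close> is at most \<open>p\<close> and at most \<open>h j\<close>, because some combination
  of its first \<open>j + 1\<close> eigenvectors is orthogonal to \<open>e 0, \<dots>, e (j - 1)\<close>.
\<close>

lemma sum_form_le_sum_min_eigenvalues:
  fixes L :: "'b \<Rightarrow> nat \<Rightarrow> complex" and h :: "nat \<Rightarrow> real" and p :: real
  assumes e: "orthonormal {..<d} d e"
    and h: "\<And>i j. i \<le> j \<Longrightarrow> j < d \<Longrightarrow> h j \<le> h i" "\<And>j. j < d \<Longrightarrow> 0 \<le> h j"
    and p: "0 \<le> p"
    and le_p: "\<And>f. (\<Sum>b\<in>B. (cmod (\<Sum>t<d. L b t * f t))\<^sup>2) \<le> p * sqnorm {..<d} f"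
    and le_h: "\<And>f. (\<Sum>b\<in>B. (cmod (\<Sum>t<d. L b t * f t))\<^sup>2) \<le>
        (\<Sum>r<d. h r * (cmod (cip {..<d} (e r) f))\<^sup>2)"
    and v: "sub_orthonormal {..<d} q v" and q: "q \<le> d"
  shows "(\<Sum>j<q. \<Sum>b\<in>B. (cmod (\<Sum>t<d. L b t * v j t))\<^sup>2) \<le> (\<Sum>j<q. min p (h j))"
proof -
  define g where "g b j = (\<Sum>t<d. L b t * v j t)" for b j
  \<comment> \<open>The matrix of the form in the family \<open>v\<close>, that is, its compression
    to the span of the \<open>v j\<close>.\<close>
  define H where "H i j = (\<Sum>b\<in>B. cnj (g b i) * g b j)" for i j
  have H: "H i j = cnj (H j i)" for i j by (simp add: H_def mult.commute)
  obtain c \<mu> where "eigen_expansion q H c \<mu>"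
    by (rule hermitian_spectral [of q H, OF H])
  then have c: "orthonormal {..<q} q c"
    and \<mu>: "\<And>i j. i \<le> j \<Longrightarrow> j < q \<Longrightarrow> \<mu> j \<le> \<mu> i"
    and Hc: "\<And>i j. i < q \<Longrightarrow> j < q \<Longrightarrow> H i j = (\<Sum>r<q. of_real (\<mu> r) * (c r i * cnj (c r j)))"
    by (auto simp: eigen_expansion_def)
  have "complex_of_real (\<Sum>j<q. \<Sum>b\<in>B. (cmod (g b j))\<^sup>2) = (\<Sum>j<q. H j j)"
    unfolding H_def of_real_sum complex_norm_square by (simp only: mult.commute)
  also have "\<dots> = complex_of_real (\<Sum>j<q. \<mu> j)"
    by (rule spectral_trace [OF Hc c])
  \<comment> \<open>The left side of the claim is the trace of \<open>H\<close>, so it suffices to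
    bound each eigenvalue \<open>\<mu> j\<close> separately.\<close>
  finally have trace: "(\<Sum>j<q. \<Sum>b\<in>B. (cmod (g b j))\<^sup>2) = (\<Sum>j<q. \<mu> j)"
    by (simp only: of_real_eq_iff)
  have "\<mu> j \<le> min p (h j)" if j: "j < q" for j
  proof -
    \<comment> \<open>The eigenvector \<open>c r\<close> of \<open>H\<close> carried over to the
      span of the \<open>v i\<close>.\<close>
    define w where "w r t = (\<Sum>i<q. c r i * v i t)" for r t
    obtain \<gamma> where \<gamma>0: "\<exists>r\<le>j. \<gamma> r \<noteq> 0"
      and orth: "\<And>s. s < j \<Longrightarrow> (\<Sum>r\<le>j. cip {..<d} (e s) (w r) * \<gamma> r) = 0"
      using homogeneous_system_nontrivial_solution [of j "\<lambda>s r. cip {..<d} (e s) (w r)"] by blast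
    define N where "N = (\<Sum>r\<le>j. (cmod (\<gamma> r))\<^sup>2)"
    \<comment> \<open>The test vector: \<open>x\<close> holds its coordinates with respect to
      \<open>v\<close>, and \<open>f\<close> is the vector itself.\<close>
    define x where "x i = (\<Sum>r<Suc j. \<gamma> r * c r i)" for i
    define f where "f t = (\<Sum>i<q. x i * v i t)" for t
    have N: "N > 0"
    proof -
      obtain r where "r \<le> j" "\<gamma> r \<noteq> 0" using \<gamma>0 by blast
      then show ?thesis unfolding N_def by (intro sum_pos2 [of _ r]) auto
    qed
    have "sqnorm {..<d} f \<le> sqnorm {..<q} x"
      unfolding f_def using sqnorm_sum_sub_orthonormal_le [OF v, of x] by (simp add: sqnorm_def)
    also have "\<dots> \<le> N"
      unfolding x_def N_def lessThan_Suc_atMost [symmetric]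
      by (rule sqnorm_sum_sub_orthonormal_le)
        (use sub_orthonormal_mono [OF orthonormal_imp_sub_orthonormal [OF c]] j in simp)
    finally have fN: "sqnorm {..<d} f \<le> N" .
    have f_w: "f = (\<lambda>t. \<Sum>r<Suc j. \<gamma> r * w r t)"
      unfolding f_def x_def w_def sum_distrib_left sum_distrib_right mult.assoc
      by (intro ext sum.swap)
    have orth_f: "cip {..<d} (e s) f = 0" if "s < j" for s
      unfolding f_w cip_sum_right cip_scale_right lessThan_Suc_atMost
      using orth [OF that] by (simp add: mult.commute)
    have cx: "cip {..<q} (c r) x = (if r \<le> j then \<gamma> r else 0)" if "r < q" for r
    proof -
      have "cip {..<q} (c r) x = (\<Sum>s<Suc j. \<gamma> s * cip {..<q} (c r) (c s))"
        unfolding x_def cip_sum_right cip_scale_right ..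
      also have "\<dots> = (\<Sum>s<Suc j. if r = s then \<gamma> s else 0)"
        using c that j by (intro sum.cong) (auto simp: orthonormal_def)
      finally show ?thesis by (simp add: less_Suc_eq_le del: sum.lessThan_Suc)
    qed
    have gx: "(\<Sum>i<q. g b i * x i) = (\<Sum>t<d. L b t * f t)" for b
    proof -
      have "(\<Sum>i<q. g b i * x i) = (\<Sum>i<q. \<Sum>t<d. L b t * (x i * v i t))"
        by (simp add: g_def sum_distrib_left sum_distrib_right mult_ac)
      also have "\<dots> = (\<Sum>t<d. L b t * f t)"
        unfolding f_def sum_distrib_left by (rule sum.swap)
      finally show ?thesis .
    qed
    have "complex_of_real (\<Sum>b\<in>B. (cmod (\<Sum>t<d. L b t * f t))\<^sup>2) =
        (\<Sum>i<q. \<Sum>j<q. cnj (x i) * H i j * x j)"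
      unfolding gx [symmetric] H_def by (rule gram_quadratic_form [symmetric])
    also have "\<dots> = complex_of_real (\<Sum>r<q. \<mu> r * (cmod (cip {..<q} (c r) x))\<^sup>2)"
      by (rule spectral_quadratic_form) (rule Hc)
    finally have form: "(\<Sum>b\<in>B. (cmod (\<Sum>t<d. L b t * f t))\<^sup>2) =
        (\<Sum>r<q. \<mu> r * (cmod (cip {..<q} (c r) x))\<^sup>2)"
      by (simp only: of_real_eq_iff)
    \<comment> \<open>Only the first \<open>j + 1\<close> eigenvectors of \<open>H\<close> occur in
      \<open>x\<close>, and their eigenvalues are at least \<open>\<mu> j\<close>.\<close>
    also have "\<dots> = (\<Sum>r\<le>j. \<mu> r * (cmod (\<gamma> r))\<^sup>2)"
      using j by (intro sum.mono_neutral_cong_right) (auto simp: cx)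
    also have "\<dots> \<ge> (\<Sum>r\<le>j. \<mu> j * (cmod (\<gamma> r))\<^sup>2)"
      using j by (intro sum_mono mult_right_mono \<mu>) auto
    finally have lower: "\<mu> j * N \<le> (\<Sum>b\<in>B. (cmod (\<Sum>t<d. L b t * f t))\<^sup>2)"
      by (simp add: N_def sum_distrib_left)
    have "\<mu> j * N \<le> p * N"
      using lower le_p [of f] mult_left_mono [OF fN p] by linarith
    moreover have "\<mu> j * N \<le> h j * N"
    proof -
      \<comment> \<open>Terms with \<open>r < j\<close> vanish by orthogonality; the others have
        \<open>h r \<le> h j\<close>.\<close>
      have "(\<Sum>r<d. h r * (cmod (cip {..<d} (e r) f))\<^sup>2) \<le>
          (\<Sum>r<d. h j * (cmod (cip {..<d} (e r) f))\<^sup>2)"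
      proof (intro sum_mono)
        fix r assume "r \<in> {..<d}"
        then show "h r * (cmod (cip {..<d} (e r) f))\<^sup>2 \<le> h j * (cmod (cip {..<d} (e r) f))\<^sup>2"
          using orth_f [of r] h(1) [of j r] by (cases "r < j") (auto intro: mult_right_mono)
      qed
      also have "\<dots> \<le> h j * sqnorm {..<d} f"
        unfolding sum_distrib_left [symmetric]
        using bessel [OF orthonormal_imp_sub_orthonormal [OF e], of f] h(2) j q
        by (intro mult_left_mono) auto
      also have "\<dots> \<le> h j * N"
        using fN h(2) j q by (intro mult_left_mono) auto
      finally show ?thesis using lower le_h [of f] by linarith
    qed
    ultimately show ?thesis using N by simp
  qed
  then show ?thesis
    unfolding g_def [symmetric] trace by (intro sum_mono) auto
qed

text \<open>This is \<open>v_i^* X v_j\<close>, the matrix entry of \<open>X\<close> relative to the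
  family \<open>v\<close>.\<close>

definition entry_in ::
    "nat \<Rightarrow> (nat \<Rightarrow> nat \<Rightarrow> complex) \<Rightarrow> (nat \<times> nat \<Rightarrow> complex) \<Rightarrow> nat \<Rightarrow> nat \<Rightarrow> complex" where
  "entry_in d v X i j = (\<Sum>p<d. \<Sum>q<d. cnj (v i p) * X (p, q) * v j q)"

lemma sqnorm_tensor:
  "sqnorm (S \<times> T) (\<lambda>(s, t). x s * y t) = sqnorm S x * sqnorm T y"
  by (simp add: sqnorm_def sum_product sum.cartesian_product norm_mult power_mult_distrib
      case_prod_unfold)

text \<open>
  The heights \<open>h j\<close> are the eigenvalues of \<open>\<Sum>a. X\<^sub>a\<^sup>* X\<^sub>a\<close>, where \<open>X\<^sub>a\<close> is \<open>x a\<close> read as a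
  \<open>d \<times> d\<close> matrix.
\<close>

lemma column_heights:
  fixes x :: "nat \<Rightarrow> nat \<times> nat \<Rightarrow> complex"
  assumes x: "sub_orthonormal ({..<d} \<times> {..<d}) k x"
  shows "\<exists>h :: nat \<Rightarrow> real. (\<forall>j<d. 0 \<le> h j) \<and> (\<Sum>j<d. h j) \<le> real k \<and>
    (\<forall>v p q. sub_orthonormal {..<d} d v \<longrightarrow> p \<le> d \<longrightarrow> q \<le> d \<longrightarrow>
      (\<Sum>i<p. \<Sum>j<q. \<Sum>a<k. (cmod (entry_in d v (x a) i j))\<^sup>2)
      \<le> (\<Sum>j<q. min (real p) (h j)))"
proof -
  \<comment> \<open>Indexing by pairs stacks the rows of all the matrices \<open>X_a\<close>; the
    Gram matrix of the stack is the sum of the \<open>X_a^* X_a\<close>.\<close>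
  define B where "B = {..<k} \<times> {..<d}"
  define W where "W t t' = (\<Sum>b\<in>B. cnj (x (fst b) (snd b, t)) * x (fst b) (snd b, t'))" for t t'
  have W: "W i j = cnj (W j i)" for i j by (simp add: W_def mult.commute)
  obtain e h where "eigen_expansion d W e h"
    by (rule hermitian_spectral [of d W, OF W])
  then have e: "orthonormal {..<d} d e"
    and h: "\<And>i j. i \<le> j \<Longrightarrow> j < d \<Longrightarrow> h j \<le> h i"
    and We: "\<And>i j. i < d \<Longrightarrow> j < d \<Longrightarrow> W i j = (\<Sum>r<d. of_real (h r) * (e r i * cnj (e r j)))"
    by (auto simp: eigen_expansion_def)
  have form: "(\<Sum>a<k. \<Sum>s<d. (cmod (\<Sum>t<d. x a (s, t) * f t))\<^sup>2) =
      (\<Sum>r<d. h r * (cmod (cip {..<d} (e r) f))\<^sup>2)" for f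
  proof -
    have "complex_of_real (\<Sum>b\<in>B. (cmod (\<Sum>t<d. x (fst b) (snd b, t) * f t))\<^sup>2) =
        (\<Sum>i<d. \<Sum>j<d. cnj (f i) * W i j * f j)"
      unfolding W_def by (rule gram_quadratic_form [symmetric])
    also have "\<dots> = complex_of_real (\<Sum>r<d. h r * (cmod (cip {..<d} (e r) f))\<^sup>2)"
      by (rule spectral_quadratic_form) (rule We)
    finally show ?thesis
      by (simp only: of_real_eq_iff) (simp add: B_def sum.cartesian_product')
  qed
  have h0: "0 \<le> h j" if "j < d" for j
  proof -
    have "0 \<le> (\<Sum>r<d. h r * (cmod (cip {..<d} (e r) (e j)))\<^sup>2)"
      unfolding form [symmetric] by (intro sum_nonneg) auto
    also have "\<dots> = (\<Sum>r<d. if r = j then h r else 0)"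
      using e that by (intro sum.cong) (auto simp: orthonormal_def)
    finally show ?thesis using that by simp
  qed
  \<comment> \<open>The trace of \<open>W\<close> is the sum of the squared Hilbert--Schmidt norms
    of the \<open>X_a\<close>, each at most 1.\<close>
  have "complex_of_real (\<Sum>j<d. h j) = (\<Sum>t<d. W t t)"
    by (rule spectral_trace [OF We e, symmetric])
  also have "\<dots> = complex_of_real (\<Sum>t<d. \<Sum>b\<in>B. (cmod (x (fst b) (snd b, t)))\<^sup>2)"
    unfolding W_def of_real_sum complex_norm_square by (simp only: mult.commute)
  finally have "(\<Sum>j<d. h j) = (\<Sum>t<d. \<Sum>b\<in>B. (cmod (x (fst b) (snd b, t)))\<^sup>2)"
    by (simp only: of_real_eq_iff)
  also have "\<dots> = (\<Sum>a<k. sqnorm ({..<d} \<times> {..<d}) (x a))"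
    unfolding B_def by (subst sum.swap)
      (simp add: sqnorm_def sum.cartesian_product')
  also have "\<dots> \<le> (\<Sum>a<k. 1)"
    using x by (intro sum_mono) (auto simp: sub_orthonormal_def)
  finally have trace: "(\<Sum>j<d. h j) \<le> real k" by simp
  show ?thesis
  proof (intro exI [of _ h] conjI allI impI)
    fix v p q assume v: "sub_orthonormal {..<d} d v" and pq: "p \<le> d" "q \<le> d"
    define C where "C = {..<p} \<times> {..<k}"
    \<comment> \<open>The row vector \<open>v_i^* X_a\<close> for \<open>b = (i, a)\<close>; summing
      the squares over \<open>C\<close> gives the form of the operator \<open>R\<close>.\<close>
    define L where "L b t = (\<Sum>s<d. cnj (v (fst b) s) * x (snd b) (s, t))" for b t
    have L: "(\<Sum>t<d. L (i, a) t * f t) = cip {..<d} (v i) (\<lambda>s. \<Sum>t<d. x a (s, t) * f t)" for i a f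
      unfolding L_def cip_def by (simp add: sum_distrib_left sum_distrib_right mult.assoc) (rule sum.swap)
    have "(\<Sum>j<q. \<Sum>b\<in>C. (cmod (\<Sum>t<d. L b t * v j t))\<^sup>2) \<le> (\<Sum>j<q. min (real p) (h j))"
    proof (rule sum_form_le_sum_min_eigenvalues [OF e h h0])
      fix f :: "nat \<Rightarrow> complex"
      have "(\<Sum>b\<in>C. (cmod (\<Sum>t<d. L b t * f t))\<^sup>2) =
          (\<Sum>i<p. \<Sum>a<k. (cmod (\<Sum>t<d. L (i, a) t * f t))\<^sup>2)"
        by (simp add: C_def sum.cartesian_product')
      also have "\<dots> \<le> (\<Sum>i<p. sqnorm {..<d} f)"
      proof (intro sum_mono)
        fix i assume i: "i \<in> {..<p}"
        \<comment> \<open>The rank-one matrix \<open>v_i f^*\<close>. Since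
          \<open>v_i^* X_a f\<close> is the conjugate of its inner product with \<open>X_a\<close>,
          Bessel over \<open>a\<close> bounds each \<open>i\<close> by the squared norm of
          \<open>f\<close>, hence the total by \<open>p\<close> times it.\<close>
        define y where "y = (\<lambda>(s, t). v i s * cnj (f t))"
        have "(\<Sum>t<d. L (i, a) t * f t) = cnj (cip ({..<d} \<times> {..<d}) (x a) y)" for a
          unfolding L by (simp add: cip_def y_def sum.cartesian_product' sum_distrib_left mult_ac)
        then have "(\<Sum>a<k. (cmod (\<Sum>t<d. L (i, a) t * f t))\<^sup>2) \<le> sqnorm ({..<d} \<times> {..<d}) y"
          using bessel [OF x, of y] by simp
        also have "\<dots> = sqnorm {..<d} (v i) * sqnorm {..<d} f"
          unfolding y_def sqnorm_tensor by (simp add: sqnorm_def)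
        also have "\<dots> \<le> sqnorm {..<d} f"
        proof -
          have "sqnorm {..<d} (v i) \<in> {0, 1}"
            using v i pq(1) by (simp add: sub_orthonormal_def)
          then show ?thesis by (auto simp: sqnorm_nonneg)
        qed
        finally show "(\<Sum>a<k. (cmod (\<Sum>t<d. L (i, a) t * f t))\<^sup>2) \<le> sqnorm {..<d} f" .
      qed
      finally show "(\<Sum>b\<in>C. (cmod (\<Sum>t<d. L b t * f t))\<^sup>2) \<le> real p * sqnorm {..<d} f"
        by simp
      have "(\<Sum>b\<in>C. (cmod (\<Sum>t<d. L b t * f t))\<^sup>2) =
          (\<Sum>i<p. \<Sum>a<k. (cmod (\<Sum>t<d. L (i, a) t * f t))\<^sup>2)"
        by (simp add: C_def sum.cartesian_product')
      also have "\<dots> = (\<Sum>a<k. \<Sum>i<p. (cmod (cip {..<d} (v i) (\<lambda>s. \<Sum>t<d. x a (s, t) * f t)))\<^sup>2)"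
        unfolding L by (rule sum.swap)
      \<comment> \<open>Bessel over \<open>i\<close> this time, for each vector
        \<open>X_a f\<close>: this is \<open>R \<le> W\<close>.\<close>
      also have "\<dots> \<le> (\<Sum>a<k. sqnorm {..<d} (\<lambda>s. \<Sum>t<d. x a (s, t) * f t))"
        by (intro sum_mono bessel sub_orthonormal_mono [OF v pq(1)])
      also have "\<dots> = (\<Sum>r<d. h r * (cmod (cip {..<d} (e r) f))\<^sup>2)"
        unfolding form [symmetric] sqnorm_def ..
      finally show "(\<Sum>b\<in>C. (cmod (\<Sum>t<d. L b t * f t))\<^sup>2) \<le>
          (\<Sum>r<d. h r * (cmod (cip {..<d} (e r) f))\<^sup>2)" .
    qed (use sub_orthonormal_mono [OF v pq(2)] pq in auto)
    also have "(\<Sum>j<q. \<Sum>b\<in>C. (cmod (\<Sum>t<d. L b t * v j t))\<^sup>2) =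
        (\<Sum>j<q. \<Sum>i<p. \<Sum>a<k. (cmod (entry_in d v (x a) i j))\<^sup>2)"
      unfolding C_def
      by (simp add: sum.cartesian_product' L cip_def entry_in_def sum_distrib_left mult.assoc)
    also have "\<dots> = (\<Sum>i<p. \<Sum>j<q. \<Sum>a<k. (cmod (entry_in d v (x a) i j))\<^sup>2)"
      by (rule sum.swap)
    finally show "(\<Sum>i<p. \<Sum>j<q. \<Sum>a<k. (cmod (entry_in d v (x a) i j))\<^sup>2)
        \<le> (\<Sum>j<q. min (real p) (h j))" .
  qed (use h0 trace in auto)
qed

section \<open>Abel summation and fractional selection of largest entries\<close>

text \<open>Abel summation for \<open>z = y - x\<close>, whose partial sums are nonnegative. The
  induction keeps the stronger bound \<open>s p\<close> times the partial sum, which can only shrink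
  when \<open>s p\<close> is replaced by the next weight.\<close>

lemma sum_mult_antimono_le:
  fixes s x y :: "nat \<Rightarrow> real"
  assumes s: "\<And>i j. i \<le> j \<Longrightarrow> j < n \<Longrightarrow> s j \<le> s i" "\<And>i. i < n \<Longrightarrow> 0 \<le> s i"
    and le: "\<And>p. p \<le> n \<Longrightarrow> (\<Sum>i<p. x i) \<le> (\<Sum>i<p. y i)"
  shows "(\<Sum>i<n. s i * x i) \<le> (\<Sum>i<n. s i * y i)"
proof -
  define z where "z i = y i - x i" for i
  have Z: "0 \<le> (\<Sum>i<p. z i)" if "p \<le> n" for p
    using le [OF that] by (simp add: z_def sum_subtractf)
  have partial: "s p * (\<Sum>i<Suc p. z i) \<le> (\<Sum>i<Suc p. s i * z i)" if "p < n" for p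
    using that
  proof (induction p)
    case (Suc p)
    have "s (Suc p) * (\<Sum>i<Suc p. z i) \<le> s p * (\<Sum>i<Suc p. z i)"
      using Suc.prems by (intro mult_right_mono s Z) auto
    also have "\<dots> \<le> (\<Sum>i<Suc p. s i * z i)" using Suc by simp
    finally show ?case by (simp add: distrib_left)
  qed simp
  have "0 \<le> (\<Sum>i<n. s i * z i)"
  proof (cases n)
    case (Suc m)
    have "0 \<le> s m * (\<Sum>i<Suc m. z i)" using Suc by (intro mult_nonneg_nonneg s Z) auto
    with partial [of m] Suc show ?thesis by simp
  qed simp
  then show ?thesis by (simp add: z_def right_diff_distrib sum_subtractf)
qed

text \<open>Abel summation over \<open>j\<close>, whose hypothesis for each \<open>q\<close> is
  itself Abel summation over \<open>i\<close>.\<close>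

lemma sum_mult_mult_antimono_le:
  fixes s :: "nat \<Rightarrow> real" and x y :: "nat \<Rightarrow> nat \<Rightarrow> real"
  assumes s: "\<And>i j. i \<le> j \<Longrightarrow> j < n \<Longrightarrow> s j \<le> s i" "\<And>i. i < n \<Longrightarrow> 0 \<le> s i"
    and le: "\<And>p q. p \<le> n \<Longrightarrow> q \<le> n \<Longrightarrow> (\<Sum>i<p. \<Sum>j<q. x i j) \<le> (\<Sum>i<p. \<Sum>j<q. y i j)"
  shows "(\<Sum>i<n. \<Sum>j<n. s i * s j * x i j) \<le> (\<Sum>i<n. \<Sum>j<n. s i * s j * y i j)"
proof -
  have "(\<Sum>j<n. s j * (\<Sum>i<n. s i * x i j)) \<le> (\<Sum>j<n. s j * (\<Sum>i<n. s i * y i j))"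
  proof (rule sum_mult_antimono_le [OF s])
    fix q assume q: "q \<le> n"
    have "(\<Sum>i<n. s i * (\<Sum>j<q. x i j)) \<le> (\<Sum>i<n. s i * (\<Sum>j<q. y i j))"
      by (rule sum_mult_antimono_le [OF s]) (use le q in auto)
    moreover have "(\<Sum>i<n. s i * (\<Sum>j<q. f i j)) = (\<Sum>j<q. \<Sum>i<n. s i * f i j)" for f
      unfolding sum_distrib_left by (rule sum.swap)
    ultimately show "(\<Sum>j<q. \<Sum>i<n. s i * x i j) \<le> (\<Sum>j<q. \<Sum>i<n. s i * y i j)" by simp
  qed
  moreover have "(\<Sum>i<n. \<Sum>j<n. s i * s j * f i j) = (\<Sum>j<n. s j * (\<Sum>i<n. s i * f i j))" for f
    unfolding sum_distrib_left by (subst sum.swap) (simp add: mult_ac)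
  ultimately show ?thesis by simp
qed

text \<open>A column of height \<open>h\<close> cut into unit cells: the lower cells are full, at
  most one is partly filled, the rest are empty.\<close>

lemma sum_clamp:
  assumes "0 \<le> (h :: real)"
  shows "(\<Sum>i<p. max 0 (min 1 (h - real i))) = min (real p) h"
proof (induction p)
  case 0
  then show ?case using assms by simp
next
  case (Suc p)
  then show ?case by auto
qed

lemma sum_pair_index:
  fixes f :: "nat \<Rightarrow> 'a :: comm_monoid_add"
  shows "(\<Sum>c<d * d. f c) = (\<Sum>i<d. \<Sum>j<d. f (i * d + j))"
proof -
  have "(\<Sum>c<d * d. f c) = (\<Sum>i<d. sum f {i * d..<i * d + d})"
    by (rule sum.nat_group [symmetric])
  also have "\<dots> = (\<Sum>i<d. \<Sum>j<d. f (i * d + j))"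
    by (subst sum.atLeastLessThan_shift_0) (simp add: atLeast0LessThan)
  finally show ?thesis .
qed

text \<open>Compare with the threshold \<open>t\<close>, the \<open>k\<close>-th largest entry: the
  sum of \<open>w c * (y $ c - t)\<close> is at most the sum of the positive parts of
  \<open>y $ c - t\<close>, and the remaining \<open>t\<close> times the total weight is at most
  \<open>t * k\<close>. Together these bounds give the sum of the \<open>k\<close> largest entries.
  As the total weight may be below \<open>k\<close>, nonnegativity of \<open>t\<close> is
  used.\<close>

lemma fractional_sum_le_top_sum:
  fixes w :: "nat \<Rightarrow> real"
  assumes k: "0 < k" "k \<le> dim_vec y"
    and w: "\<And>c. c < dim_vec y \<Longrightarrow> 0 \<le> w c" "\<And>c. c < dim_vec y \<Longrightarrow> w c \<le> 1"
      "(\<Sum>c<dim_vec y. w c) \<le> real k"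
    and y: "\<And>c. c < dim_vec y \<Longrightarrow> 0 \<le> y $ c"
  shows "(\<Sum>c<dim_vec y. w c * y $ c) \<le> (\<Sum>i<k. decreasing_rearrangement y $ i)"
proof -
  let ?n = "dim_vec y"
  define ys where "ys = rev (sort (list_of_vec y))"
  have len: "length ys = ?n" by (simp add: ys_def)
  have mset: "mset ys = mset (list_of_vec y)" by (simp add: ys_def)
  have dec: "ys ! j \<le> ys ! i" if "i \<le> j" "j < ?n" for i j
    using that sorted_nth_mono [of "sort (list_of_vec y)" "?n - Suc j" "?n - Suc i"]
    by (simp add: ys_def rev_nth)
  define t where "t = ys ! (k - 1)"
  have "t \<in> set ys" using k len by (simp add: t_def)
  also have "set ys = set (list_of_vec y)" using mset by (rule mset_eq_setD)
  finally have t: "0 \<le> t"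
    using y by (auto simp: in_set_conv_nth list_of_vec_index)
  have "(\<Sum>c<?n. w c * y $ c) = (\<Sum>c<?n. w c * (y $ c - t)) + t * (\<Sum>c<?n. w c)"
    by (simp add: right_diff_distrib sum_subtractf sum_distrib_left mult.commute)
  also have "\<dots> \<le> (\<Sum>c<?n. max 0 (y $ c - t)) + t * real k"
  proof (intro add_mono sum_mono mult_left_mono w t)
    fix c assume "c \<in> {..<?n}"
    then have "0 \<le> w c" "w c \<le> 1" using w by auto
    then have "w c * (y $ c - t) \<le> w c * max 0 (y $ c - t)"
      by (intro mult_left_mono) auto
    also have "\<dots> \<le> max 0 (y $ c - t)"
      using \<open>w c \<le> 1\<close> by (intro mult_left_le_one_le) (use \<open>0 \<le> w c\<close> in auto)
    finally show "w c * (y $ c - t) \<le> max 0 (y $ c - t)" .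
  qed
  also have "(\<Sum>c<?n. max 0 (y $ c - t)) = (\<Sum>z\<leftarrow>list_of_vec y. max 0 (z - t))"
    by (simp add: sum_list_sum_nth list_of_vec_index atLeast0LessThan)
  also have "\<dots> = (\<Sum>z\<leftarrow>ys. max 0 (z - t))"
    using mset by (metis mset_map sum_mset_sum_list)
  also have "\<dots> = (\<Sum>c<?n. max 0 (ys ! c - t))"
    by (simp add: sum_list_sum_nth len atLeast0LessThan)
  also have "\<dots> = (\<Sum>c<k. ys ! c - t)"
    using k by (intro sum.mono_neutral_cong_right) (auto simp: t_def max_def dec not_less intro!: antisym dec)
  also have "\<dots> + t * real k = (\<Sum>c<k. ys ! c)"
    by (simp add: sum_subtractf)
  finally show ?thesis
    by (simp add: decreasing_rearrangement_def ys_def vec_of_list_index)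
qed

lemma decreasing_rearrangement_decreasing:
  assumes "\<And>i j. i \<le> j \<Longrightarrow> j < dim_vec y \<Longrightarrow> y $ j \<le> y $ i"
  shows "decreasing_rearrangement y = y"
proof -
  have "sorted (rev (list_of_vec y))"
    unfolding sorted_iff_nth_mono using assms by (simp add: rev_nth list_of_vec_index)
  then have "sort (list_of_vec y) = rev (list_of_vec y)" by (intro properties_for_sort) simp_all
  then show ?thesis by (simp add: decreasing_rearrangement_def vec_list)
qed

text \<open>
  The witness is the staircase \<open>w i j = max 0 (min 1 (h j - i))\<close>. It must not depend on \<open>v\<close>,
  so that the same weights serve all Kraus operators.
\<close>

lemma weighted_sum_le_staircase:
  fixes x :: "nat \<Rightarrow> nat \<times> nat \<Rightarrow> complex"
  assumes x: "sub_orthonormal ({..<d} \<times> {..<d}) k x"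
  shows "\<exists>w :: nat \<Rightarrow> nat \<Rightarrow> real. (\<forall>i j. 0 \<le> w i j \<and> w i j \<le> 1) \<and> (\<Sum>i<d. \<Sum>j<d. w i j) \<le> real k \<and>
    (\<forall>v s. sub_orthonormal {..<d} d v \<longrightarrow> (\<forall>i j. i \<le> j \<longrightarrow> j < d \<longrightarrow> s j \<le> s i) \<longrightarrow> (\<forall>i<d. 0 \<le> s i) \<longrightarrow>
      (\<Sum>i<d. \<Sum>j<d. s i * s j *
        (\<Sum>a<k. (cmod (entry_in d v (x a) i j))\<^sup>2))
      \<le> (\<Sum>i<d. \<Sum>j<d. s i * s j * w i j))"
proof -
  obtain h :: "nat \<Rightarrow> real" where h: "\<forall>j<d. 0 \<le> h j" "(\<Sum>j<d. h j) \<le> real k"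
    and rect: "\<forall>v p q. sub_orthonormal {..<d} d v \<longrightarrow> p \<le> d \<longrightarrow> q \<le> d \<longrightarrow>
      (\<Sum>i<p. \<Sum>j<q. \<Sum>a<k. (cmod (entry_in d v (x a) i j))\<^sup>2)
      \<le> (\<Sum>j<q. min (real p) (h j))"
    using column_heights [OF x] by (elim exE conjE)
  define w where "w i j = max 0 (min 1 (h j - real i))" for i j
  \<comment> \<open>The rectangle sums of \<open>w\<close> are exactly the bounds in
    \<open>rect\<close>, so Abel summation in both indices applies.\<close>
  have w: "(\<Sum>i<p. \<Sum>j<q. w i j) = (\<Sum>j<q. min (real p) (h j))" if "q \<le> d" for p q
    unfolding w_def using h(1) that by (subst sum.swap) (intro sum.cong refl sum_clamp, auto)
  show ?thesis
  proof (intro exI [of _ w] conjI allI impI)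
    \<comment> \<open>The full square contributes \<open>min d (h j)\<close> per column, at most
      \<open>h j\<close>.\<close>
    show "(\<Sum>i<d. \<Sum>j<d. w i j) \<le> real k"
      using h(2) sum_mono [of "{..<d}" "\<lambda>j. min (real d) (h j)" h] by (simp add: w)
    fix v :: "nat \<Rightarrow> nat \<Rightarrow> complex" and s :: "nat \<Rightarrow> real"
    assume v: "sub_orthonormal {..<d} d v"
      and s: "\<forall>i j. i \<le> j \<longrightarrow> j < d \<longrightarrow> s j \<le> s i" "\<forall>i<d. 0 \<le> s i"
    show "(\<Sum>i<d. \<Sum>j<d. s i * s j *
        (\<Sum>a<k. (cmod (entry_in d v (x a) i j))\<^sup>2))
      \<le> (\<Sum>i<d. \<Sum>j<d. s i * s j * w i j)"
      by (rule sum_mult_mult_antimono_le) (use s rect v in \<open>simp_all add: w\<close>)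
  qed (simp_all add: w_def)
qed

section \<open>Kraus terms in singular coordinates\<close>

text \<open>The left side is \<open>tr (Y^* K X K^* )\<close> in coordinates. Inserting the
  expansion of \<open>K\<close> in both places makes each summand split into a factor in
  \<open>y\<close> and one in \<open>x\<close>.\<close>

lemma tensor_square_form:
  fixes s :: "nat \<Rightarrow> real" and u v :: "nat \<Rightarrow> nat \<Rightarrow> complex"
  assumes K: "\<And>p q. p < d \<Longrightarrow> q < d \<Longrightarrow> K p q = (\<Sum>r<d. of_real (s r) * (u r p * cnj (v r q)))"
  shows "(\<Sum>p<d. \<Sum>p'<d. \<Sum>q<d. \<Sum>q'<d. cnj (y (p, p')) * (K p q * cnj (K p' q')) * x (q, q')) =
    (\<Sum>i<d. \<Sum>j<d. of_real (s i * s j) *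
      (cnj (entry_in d u y i j) *
       entry_in d v x i j))"
proof -
  let ?S = "{..<d} \<times> {..<d}"
  define T where "T z z' ij = of_real (s (fst ij) * s (snd ij)) *
      (cnj (cnj (u (fst ij) (fst z)) * y z * u (snd ij) (snd z)) *
       (cnj (v (fst ij) (fst z')) * x z' * v (snd ij) (snd z')))" for z z' ij
  have "(\<Sum>p<d. \<Sum>p'<d. \<Sum>q<d. \<Sum>q'<d. cnj (y (p, p')) * (K p q * cnj (K p' q')) * x (q, q')) =
      (\<Sum>z\<in>?S. \<Sum>z'\<in>?S. cnj (y z) * (K (fst z) (fst z') * cnj (K (snd z) (snd z'))) * x z')"
    by (simp add: sum.cartesian_product')
  also have "\<dots> = (\<Sum>z\<in>?S. \<Sum>z'\<in>?S. \<Sum>ij\<in>?S. T z z' ij)"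
  proof (intro sum.cong refl)
    fix z z' assume "z \<in> ?S" "z' \<in> ?S"
    then have "K (fst z) (fst z') * cnj (K (snd z) (snd z')) =
        (\<Sum>i<d. \<Sum>j<d. (of_real (s i) * (u i (fst z) * cnj (v i (fst z')))) *
          (of_real (s j) * (cnj (u j (snd z)) * v j (snd z'))))"
      by (auto simp: K sum_product)
    then show "cnj (y z) * (K (fst z) (fst z') * cnj (K (snd z) (snd z'))) * x z' = (\<Sum>ij\<in>?S. T z z' ij)"
      by (simp add: T_def sum.cartesian_product' sum_distrib_left sum_distrib_right mult_ac)
  qed
  also have "\<dots> = (\<Sum>z\<in>?S. \<Sum>ij\<in>?S. \<Sum>z'\<in>?S. T z z' ij)"
    by (intro sum.cong refl sum.swap)
  also have "\<dots> = (\<Sum>ij\<in>?S. \<Sum>z\<in>?S. \<Sum>z'\<in>?S. T z z' ij)"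
    by (rule sum.swap)
  also have "\<dots> = (\<Sum>ij\<in>?S. of_real (s (fst ij) * s (snd ij)) *
      ((\<Sum>z\<in>?S. cnj (cnj (u (fst ij) (fst z)) * y z * u (snd ij) (snd z))) *
       (\<Sum>z'\<in>?S. cnj (v (fst ij) (fst z')) * x z' * v (snd ij) (snd z'))))"
    unfolding T_def sum_product unfolding sum_distrib_left ..
  finally show ?thesis by (simp add: sum.cartesian_product' entry_in_def)
qed

lemma Re_mult_le_half_squares: "Re (cnj b * a) \<le> ((cmod a)\<^sup>2 + (cmod b)\<^sup>2) / 2"
proof -
  have "Re (cnj b * a) \<le> cmod (cnj b * a)" by (rule complex_Re_le_cmod)
  also have "\<dots> \<le> ((cmod a)\<^sup>2 + (cmod b)\<^sup>2) / 2"
    using sum_squares_bound [of "cmod a" "cmod b"] by (simp add: norm_mult mult_ac)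
  finally show ?thesis .
qed

section \<open>Singular values of completely positive maps\<close>

text \<open>Orthonormality of \<open>v\<close> leaves only the term
  \<open>s a * sqnorm {..<n} (u a)\<close>, which equals \<open>s a\<close> even if
  \<open>u a\<close> is zero.\<close>

lemma svd_diagonal_entry:
  assumes svd: "svd n A s u v" and a: "a < n"
  shows "(\<Sum>i<n. \<Sum>j<n. cnj (u a i) * A $$ (i, j) * v a j) = complex_of_real (s a)"
proof -
  have A: "A $$ (i, j) = (\<Sum>r<n. of_real (s r) * (u r i * cnj (v r j)))" if "i < n" "j < n" for i j
    using svd that by (simp add: svd_def)
  have v: "cip {..<n} (v r) (v a) = (if a = r then 1 else 0)" if "r < n" for r
    using svd that a by (auto simp: svd_def orthonormal_def)
  have "(\<Sum>i<n. \<Sum>j<n. cnj (u a i) * A $$ (i, j) * v a j) =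
      (\<Sum>i<n. \<Sum>j<n. \<Sum>r<n. of_real (s r) * ((cnj (u a i) * u r i) * (cnj (v r j) * v a j)))"
    by (intro sum.cong refl) (simp add: A sum_distrib_left sum_distrib_right mult_ac)
  also have "\<dots> = (\<Sum>i<n. \<Sum>r<n. \<Sum>j<n. of_real (s r) * ((cnj (u a i) * u r i) * (cnj (v r j) * v a j)))"
    by (intro sum.cong refl sum.swap)
  also have "\<dots> = (\<Sum>r<n. \<Sum>i<n. \<Sum>j<n. of_real (s r) * ((cnj (u a i) * u r i) * (cnj (v r j) * v a j)))"
    by (rule sum.swap)
  also have "\<dots> = (\<Sum>r<n. of_real (s r) * (cip {..<n} (u a) (u r) * cip {..<n} (v r) (v a)))"
    unfolding cip_def sum_product unfolding sum_distrib_left ..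
  also have "\<dots> = (\<Sum>r<n. (of_real (s r) * cip {..<n} (u a) (u r)) * (if a = r then 1 else 0))"
    by (intro sum.cong refl) (simp add: v)
  also have "\<dots> = of_real (s a) * cip {..<n} (u a) (u a)"
    by (rule sum_mult_delta [OF a])
  also have "\<dots> = complex_of_real (s a * sqnorm {..<n} (u a))"
    by (simp add: cip_self)
  also have "s a * sqnorm {..<n} (u a) = s a"
    using svd a by (simp add: svd_def)
  finally show ?thesis .
qed

text \<open>A matrix unit is sent by each Kraus term to a column of \<open>K l\<close> times the
  adjoint of a column; so the matrix of the map is the sum of the Kronecker products of
  \<open>K l\<close> with its conjugate.\<close>

lemma op_matrix_kraus_map_index:
  assumes K: "\<And>l. l \<in> {1..m} \<Longrightarrow> K l \<in> carrier_mat d d"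
    and less: "p < d" "p' < d" "q < d" "q' < d"
  shows "op_matrix d (matrix_unit d) (kraus_map d m K) $$ (p * d + p', q * d + q') =
    (\<Sum>l=1..m. K l $$ (p, q) * cnj (K l $$ (p', q')))"
proof -
  let ?E = "matrix_unit d (q * d + q')"
  have "(K l * ?E * mat_adjoint (K l)) $$ (p, p') = K l $$ (p, q) * cnj (K l $$ (p', q'))"
    if "l \<in> {1..m}" for l
  proof -
    have "(\<Sum>a<d. K l $$ (p, a) * ?E $$ (a, b)) = (if b = q' then K l $$ (p, q) else 0)" if "b < d" for b
      using less that by (simp add: matrix_unit_def if_distrib [of "\<lambda>x. _ * x"] cong: if_cong)
    then show ?thesis
      using K [OF that] less
      by (simp add: scalar_prod_def atLeast0LessThan if_distrib [of "\<lambda>x. x * _"]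
          carrier_matD [OF matrix_unit_carrier] cong: if_cong)
  qed
  moreover have "kraus_map d m K X \<in> carrier_mat d d" for X by (simp add: kraus_map_def)
  ultimately show ?thesis
    using less by (simp add: op_matrix_def pair_index_less hs_inner_matrix_unit kraus_map_def)
qed

lemma sub_orthonormal_pair_index:
  fixes d :: nat
  assumes "sub_orthonormal {..<d * d} k x"
  shows "sub_orthonormal ({..<d} \<times> {..<d}) k (\<lambda>a (i, j). x a (i * d + j))"
  using assms
  unfolding sub_orthonormal_def cip_def sqnorm_def sum_pair_index sum.cartesian_product' by simp

theorem mainTheorem2:
  fixes m d :: nat and K :: "nat \<Rightarrow> complex mat"
  assumes "m > 0" and "d > 0"
    and "\<And>l. l \<in> {1..m} \<Longrightarrow> K l \<in> carrier_mat d d"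
  shows "op_singular_values d (kraus_map d m K) \<prec>\<^sub>w
    finsum_vec TYPE(real) (d * d) (\<lambda>l. singular_values (K l) \<otimes>\<^sub>v singular_values (K l)) {1..m}"
proof -
  note K = assms(3)
  define M where "M = op_matrix d (matrix_unit d) (kraus_map d m K)"
  have M: "M \<in> carrier_mat (d * d) (d * d)" by (simp add: M_def op_matrix_def)
  have M_index: "M $$ (p * d + p', q * d + q') = (\<Sum>l=1..m. K l $$ (p, q) * cnj (K l $$ (p', q')))"
    if "p < d" "p' < d" "q < d" "q' < d" for p p' q q'
    unfolding M_def by (rule op_matrix_kraus_map_index [OF K that])
  obtain r y0 x0 where svdM: "svd (d * d) M r y0 x0"
    by (rule singular_value_decomposition [OF M])
  \<comment> \<open>Left and right singular vectors of \<open>M\<close>, read as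
    \<open>d x d\<close> matrices.\<close>
  define y where "y = (\<lambda>a (i, j). y0 a (i * d + j))"
  define x where "x = (\<lambda>a (i, j). x0 a (i * d + j))"
  \<comment> \<open>Membership of \<open>l\<close> stands under the existential quantifiers so that
    choice yields total functions of \<open>l\<close>.\<close>
  have "\<forall>l. \<exists>s u v. l \<in> {1..m} \<longrightarrow> svd d (K l) s u v"
    using K singular_value_decomposition by metis
  then obtain s u v where svdK: "\<And>l. l \<in> {1..m} \<Longrightarrow> svd d (K l) (s l) (u l) (v l)"
    by metis
  define Y where "Y = finsum_vec TYPE(real) (d * d)
    (\<lambda>l. singular_values (K l) \<otimes>\<^sub>v singular_values (K l)) {1..m}"
  have dim_s: "dim_vec (singular_values (K l)) = d" if "l \<in> {1..m}" for l
    using dim_singular_values [OF K [OF that]] .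
  have closed: "(\<lambda>l. singular_values (K l) \<otimes>\<^sub>v singular_values (K l)) \<in> {1..m} \<rightarrow> carrier_vec (d * d)"
    using dim_s by (auto simp: tensor_vec_def)
  have dimY: "dim_vec Y = d * d"
    using finsum_vec_closed [OF closed] by (simp add: Y_def)
  have Y: "Y $ (i * d + j) = (\<Sum>l=1..m. s l i * s l j)" if ij: "i < d" "j < d" for i j
  proof -
    have "Y $ (i * d + j) = (\<Sum>l=1..m. (singular_values (K l) \<otimes>\<^sub>v singular_values (K l)) $ (i * d + j))"
      unfolding Y_def by (rule index_finsum_vec [OF _ _ closed]) (simp_all add: pair_index_less ij)
    also have "\<dots> = (\<Sum>l=1..m. s l i * s l j)"
      using svdK ij by (intro sum.cong refl) (simp add: tensor_vec_def dim_s pair_index_less svd_def)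
    finally show ?thesis .
  qed
  have dim_op: "dim_vec (op_singular_values d (kraus_map d m K)) = d * d"
    unfolding op_singular_values_def M_def [symmetric] by (rule dim_singular_values [OF M])
  have op: "op_singular_values d (kraus_map d m K) $ a = r a" if "a < d * d" for a
    using svdM that by (simp add: op_singular_values_def M_def svd_def)
  have op_sorted: "decreasing_rearrangement (op_singular_values d (kraus_map d m K)) =
      op_singular_values d (kraus_map d m K)"
    using svdM by (intro decreasing_rearrangement_decreasing) (simp add: dim_op op svd_def)
  have Y0: "0 \<le> Y $ c" if "c < d * d" for c
  proof -
    have "c div d < d" "c mod d < d" using index_div_mod [OF that] by auto
    moreover have "0 \<le> s l i" if "l \<in> {1..m}" "i < d" for l i
      using svdK [OF that(1)] that(2) by (simp add: svd_def)
    ultimately have "0 \<le> Y $ (c div d * d + c mod d)"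
      unfolding Y [OF \<open>c div d < d\<close> \<open>c mod d < d\<close>] by (intro sum_nonneg mult_nonneg_nonneg)
    then show ?thesis by simp
  qed
  have "(\<Sum>a<k. decreasing_rearrangement (op_singular_values d (kraus_map d m K)) $ a) \<le>
      (\<Sum>a<k. decreasing_rearrangement Y $ a)" if k: "0 < k" "k \<le> d * d" for k
  proof -
    \<comment> \<open>Stated for arbitrary families because it is applied twice: to the
      \<open>x a\<close> with right singular vectors, and to the \<open>y a\<close> with left
      ones.\<close>
    have bound: "(\<Sum>l=1..m. \<Sum>i<d. \<Sum>j<d. s l i * s l j * (\<Sum>a<k. (cmod (entry_in d (w l) (z a) i j))\<^sup>2)) \<le>
        (\<Sum>a<k. decreasing_rearrangement Y $ a)"
      if z: "sub_orthonormal ({..<d} \<times> {..<d}) k z"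
        and w: "\<And>l. l \<in> {1..m} \<Longrightarrow> sub_orthonormal {..<d} d (w l)" for w z
    proof -
      obtain \<omega> :: "nat \<Rightarrow> nat \<Rightarrow> real" where
        "(\<forall>i j. 0 \<le> \<omega> i j \<and> \<omega> i j \<le> 1) \<and> (\<Sum>i<d. \<Sum>j<d. \<omega> i j) \<le> real k \<and>
        (\<forall>v s. sub_orthonormal {..<d} d v \<longrightarrow> (\<forall>i j. i \<le> j \<longrightarrow> j < d \<longrightarrow> s j \<le> s i) \<longrightarrow>
          (\<forall>i<d. 0 \<le> s i) \<longrightarrow>
          (\<Sum>i<d. \<Sum>j<d. s i * s j * (\<Sum>a<k. (cmod (entry_in d v (z a) i j))\<^sup>2))
          \<le> (\<Sum>i<d. \<Sum>j<d. s i * s j * \<omega> i j))"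
        using weighted_sum_le_staircase [OF z] ..
      then have \<omega>: "\<And>i j. 0 \<le> \<omega> i j" "\<And>i j. \<omega> i j \<le> 1" "(\<Sum>i<d. \<Sum>j<d. \<omega> i j) \<le> real k"
        and le: "\<And>v s. sub_orthonormal {..<d} d v \<Longrightarrow> \<forall>i j. i \<le> j \<longrightarrow> j < d \<longrightarrow> s j \<le> s i \<Longrightarrow>
          \<forall>i<d. 0 \<le> s i \<Longrightarrow>
          (\<Sum>i<d. \<Sum>j<d. s i * s j * (\<Sum>a<k. (cmod (entry_in d v (z a) i j))\<^sup>2))
          \<le> (\<Sum>i<d. \<Sum>j<d. s i * s j * \<omega> i j)"
        by simp_all
      have "(\<Sum>l=1..m. \<Sum>i<d. \<Sum>j<d. s l i * s l j * (\<Sum>a<k. (cmod (entry_in d (w l) (z a) i j))\<^sup>2)) \<le>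
          (\<Sum>l=1..m. \<Sum>i<d. \<Sum>j<d. s l i * s l j * \<omega> i j)"
      proof (rule sum_mono)
        fix l assume l: "l \<in> {1..m}"
        show "(\<Sum>i<d. \<Sum>j<d. s l i * s l j * (\<Sum>a<k. (cmod (entry_in d (w l) (z a) i j))\<^sup>2)) \<le>
            (\<Sum>i<d. \<Sum>j<d. s l i * s l j * \<omega> i j)"
          by (rule le [OF w [OF l]]) (use svdK [OF l] in \<open>simp_all add: svd_def\<close>)
      qed
      \<comment> \<open>The weights \<open>\<omega>\<close> depend on \<open>z\<close> only, so the
        sum over \<open>l\<close> collects into the entries of \<open>Y\<close>.\<close>
      also have "\<dots> = (\<Sum>i<d. \<Sum>j<d. \<Sum>l=1..m. s l i * s l j * \<omega> i j)"
        by (subst sum.swap) (intro sum.cong refl sum.swap)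
      also have "\<dots> = (\<Sum>i<d. \<Sum>j<d. \<omega> i j * Y $ (i * d + j))"
        by (intro sum.cong refl) (simp add: Y sum_distrib_left mult.commute)
      also have "\<dots> = (\<Sum>c<dim_vec Y. \<omega> (c div d) (c mod d) * Y $ c)"
        unfolding dimY sum_pair_index by (intro sum.cong refl) simp
      also have "\<dots> \<le> (\<Sum>a<k. decreasing_rearrangement Y $ a)"
      proof (rule fractional_sum_le_top_sum)
        have "(\<Sum>c<dim_vec Y. \<omega> (c div d) (c mod d)) = (\<Sum>i<d. \<Sum>j<d. \<omega> i j)"
          unfolding dimY sum_pair_index by (intro sum.cong refl) simp
        then show "(\<Sum>c<dim_vec Y. \<omega> (c div d) (c mod d)) \<le> real k"
          using \<omega>(3) by simp
      qed (use k \<omega> Y0 in \<open>auto simp: dimY\<close>)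
      finally show ?thesis .
    qed
    \<comment> \<open>The singular value \<open>r a\<close> is the inner product of
      \<open>Y_a\<close> with the image of \<open>X_a\<close>, expanded over the Kraus
      operators.\<close>
    have complex_r: "complex_of_real (r a) =
        (\<Sum>l=1..m. \<Sum>i<d. \<Sum>j<d. of_real (s l i * s l j) * (cnj (entry_in d (u l) (y a) i j) * entry_in d (v l) (x a) i j))"
      if a: "a < k" for a
    proof -
      have "complex_of_real (r a) = (\<Sum>p<d. \<Sum>p'<d. \<Sum>q<d. \<Sum>q'<d.
          cnj (y a (p, p')) * M $$ (p * d + p', q * d + q') * x a (q, q'))"
        using svd_diagonal_entry [OF svdM, of a] a k by (simp add: sum_pair_index x_def y_def)
      also have "\<dots> = (\<Sum>p<d. \<Sum>p'<d. \<Sum>q<d. \<Sum>q'<d. \<Sum>l=1..m.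
          cnj (y a (p, p')) * (K l $$ (p, q) * cnj (K l $$ (p', q'))) * x a (q, q'))"
        by (intro sum.cong refl) (simp add: M_index sum_distrib_left sum_distrib_right)
      also have "\<dots> = (\<Sum>l=1..m. \<Sum>p<d. \<Sum>p'<d. \<Sum>q<d. \<Sum>q'<d.
          cnj (y a (p, p')) * (K l $$ (p, q) * cnj (K l $$ (p', q'))) * x a (q, q'))"
        by (simp only: sum.swap [of _ "{1..m}"])
      also have "\<dots> = (\<Sum>l=1..m. \<Sum>i<d. \<Sum>j<d. of_real (s l i * s l j) *
          (cnj (entry_in d (u l) (y a) i j) * entry_in d (v l) (x a) i j))"
      proof (rule sum.cong [OF refl])
        fix l assume l: "l \<in> {1..m}"
        show "(\<Sum>p<d. \<Sum>p'<d. \<Sum>q<d. \<Sum>q'<d.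
            cnj (y a (p, p')) * (K l $$ (p, q) * cnj (K l $$ (p', q'))) * x a (q, q')) =
          (\<Sum>i<d. \<Sum>j<d. of_real (s l i * s l j) * (cnj (entry_in d (u l) (y a) i j) * entry_in d (v l) (x a) i j))"
          by (rule tensor_square_form [where K = "\<lambda>p q. K l $$ (p, q)"])
            (use svdK [OF l] in \<open>simp add: svd_def\<close>)
      qed
      finally show ?thesis .
    qed
    have r: "r a = (\<Sum>l=1..m. \<Sum>i<d. \<Sum>j<d. s l i * s l j * Re (cnj (entry_in d (u l) (y a) i j) * entry_in d (v l) (x a) i j))"
      if "a < k" for a
      using arg_cong [OF complex_r [OF that], of Re]
      by (simp only: Re_complex_of_real Re_sum scaleR_conv_of_real [symmetric] scaleR_complex.sel)
    define X2 where "X2 l i j = (\<Sum>a<k. (cmod (entry_in d (v l) (x a) i j))\<^sup>2)" for l i j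
    define Y2 where "Y2 l i j = (\<Sum>a<k. (cmod (entry_in d (u l) (y a) i j))\<^sup>2)" for l i j
    have "(\<Sum>a<k. decreasing_rearrangement (op_singular_values d (kraus_map d m K)) $ a) = (\<Sum>a<k. r a)"
      unfolding op_sorted using k by (intro sum.cong refl op) simp
    also have "\<dots> = (\<Sum>a<k. \<Sum>l=1..m. \<Sum>i<d. \<Sum>j<d.
        s l i * s l j * Re (cnj (entry_in d (u l) (y a) i j) * entry_in d (v l) (x a) i j))"
      using r by simp
    \<comment> \<open>AM-GM separates the \<open>x\<close> and \<open>y\<close> contributions; the
      factors \<open>s l i * s l j\<close> are nonnegative.\<close>
    also have "\<dots> \<le> (\<Sum>a<k. \<Sum>l=1..m. \<Sum>i<d. \<Sum>j<d. s l i * s l j *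
        (((cmod (entry_in d (v l) (x a) i j))\<^sup>2 + (cmod (entry_in d (u l) (y a) i j))\<^sup>2) / 2))"
      using svdK by (intro sum_mono mult_left_mono Re_mult_le_half_squares mult_nonneg_nonneg)
        (auto simp: svd_def)
    also have "\<dots> = (\<Sum>l=1..m. \<Sum>i<d. \<Sum>j<d. \<Sum>a<k. s l i * s l j *
        (((cmod (entry_in d (v l) (x a) i j))\<^sup>2 + (cmod (entry_in d (u l) (y a) i j))\<^sup>2) / 2))"
      by (simp only: sum.swap [of _ _ "{..<k}"])
    also have "\<dots> = (\<Sum>l=1..m. \<Sum>i<d. \<Sum>j<d. s l i * s l j * ((X2 l i j + Y2 l i j) / 2))"
      by (intro sum.cong refl)
        (simp only: X2_def Y2_def sum_distrib_left [symmetric] sum_divide_distrib [symmetric] sum.distrib)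
    also have "\<dots> = ((\<Sum>l=1..m. \<Sum>i<d. \<Sum>j<d. s l i * s l j * X2 l i j) +
        (\<Sum>l=1..m. \<Sum>i<d. \<Sum>j<d. s l i * s l j * Y2 l i j)) / 2"
      by (simp add: distrib_left add_divide_distrib sum.distrib sum_divide_distrib)
    also have "\<dots> \<le> ((\<Sum>a<k. decreasing_rearrangement Y $ a) + (\<Sum>a<k. decreasing_rearrangement Y $ a)) / 2"
    proof (intro divide_right_mono add_mono)
      have "orthonormal {..<d * d} (d * d) x0" "sub_orthonormal {..<d * d} (d * d) y0"
        using svdM by (auto simp: svd_def)
      then have xy: "sub_orthonormal ({..<d} \<times> {..<d}) k x" "sub_orthonormal ({..<d} \<times> {..<d}) k y"
        unfolding x_def y_def using k
        by (auto intro: sub_orthonormal_pair_index sub_orthonormal_mono orthonormal_imp_sub_orthonormal)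
      have vu: "sub_orthonormal {..<d} d (v l)" "sub_orthonormal {..<d} d (u l)" if "l \<in> {1..m}" for l
        using svdK [OF that] by (auto simp: svd_def orthonormal_imp_sub_orthonormal)
      show "(\<Sum>l=1..m. \<Sum>i<d. \<Sum>j<d. s l i * s l j * X2 l i j) \<le> (\<Sum>a<k. decreasing_rearrangement Y $ a)"
        unfolding X2_def by (rule bound [OF xy(1) vu(1)])
      show "(\<Sum>l=1..m. \<Sum>i<d. \<Sum>j<d. s l i * s l j * Y2 l i j) \<le> (\<Sum>a<k. decreasing_rearrangement Y $ a)"
        unfolding Y2_def by (rule bound [OF xy(2) vu(2)])
    qed simp
    finally show ?thesis by simp
  qed
  then show ?thesis
    unfolding weakly_majorized_def Y_def [symmetric] by (simp add: dim_op dimY)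
qed

end
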